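(* Let $d$ be a positive real number and let $G$ be a graph such that $\lVert H\rVert\leq d|H|$ for every subgraph $H$ of $G$ (in particular for every bipartite subgraph). If $\Delta(G)\geq 6.21d$, then $G$ has an equitable $r$-coloring for every integer $r\geq \Delta(G)$.
   Context: All graphs are finite and simple. For a graph $H$, $|H|$ denotes its number of vertices and $\lVert H\rVert$ its number of edges; $\Delta(G)$ is the maximum degree. (This class is denoted $\mathcal{G}_d$ in the paper.) An equitable $r$-coloring of a graph is a partition of its vertex set into $r$ independent sets $V_1,\dots,V_r$ (some possibly empty) with $\big||V_i|-|V_j|\big|\leq 1$ for all $i,j$. *)

theory Defs
  imports Complex_Main "HOL-Library.Disjoint_Sets"
begin

definition graph :: "'a set \<Rightarrow> 'a set set \<Rightarrow> bool" where
  "graph V E \<longleftrightarrow> finite V \<and> (\<forall>e\<in>E. e \<subseteq> V \<and> card e = 2)"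

definition subgraph :: "'a set \<Rightarrow> 'a set set \<Rightarrow> 'a set \<Rightarrow> 'a set set \<Rightarrow> bool" where
  "subgraph V' E' V E \<longleftrightarrow> V' \<subseteq> V \<and> E' \<subseteq> E \<and> graph V' E'"

definition degree :: "'a set set \<Rightarrow> 'a \<Rightarrow> nat" where
  "degree E v = card {e\<in>E. v \<in> e}"

definition max_degree :: "'a set \<Rightarrow> 'a set set \<Rightarrow> nat" where
  "max_degree V E = Max (insert 0 (degree E ` V))"

definition independent :: "'a set set \<Rightarrow> 'a set \<Rightarrow> bool" where
  "independent E S \<longleftrightarrow> (\<forall>e\<in>E. \<not> e \<subseteq> S)"

definition equitable_coloring :: "'a set \<Rightarrow> 'a set set \<Rightarrow> nat \<Rightarrow> (nat \<Rightarrow> 'a set) \<Rightarrow> bool" where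
  "equitable_coloring V E r C \<longleftrightarrow>
     (\<Union>i<r. C i) = V \<and> disjoint_family_on C {..<r} \<and>
     (\<forall>i<r. independent E (C i)) \<and>
     (\<forall>i<r. \<forall>j<r. card (C i) \<le> card (C j) + 1)"

definition has_equitable_coloring :: "'a set \<Rightarrow> 'a set set \<Rightarrow> nat \<Rightarrow> bool" where
  "has_equitable_coloring V E r \<longleftrightarrow> (\<exists>C. equitable_coloring V E r C)"

end

theory Submission
  imports Defs
begin

text \<open>
  By induction on the number of vertices, remove a vertex of degree at most \<open>2d\<close>, colour the rest
  and put the vertex back into some class without neighbours of it. If this class becomes too
  large, we have one class \<open>P\<close> of size \<open>s + 1\<close>, the others having size \<open>s\<close> or \<open>s - 1\<close>. Call a class
  accessible if vertices can be shifted from it, class by class, into a class of size \<open>s - 1\<close>, and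
  consider such a colouring, with a vertex of degree at most \<open>0.79r\<close> in \<open>P\<close>, that maximises the
  set \<open>A\<close> of accessible classes. Let \<open>b\<close> be the number of classes reachable from \<open>P\<close> and
  \<open>B\<close> their union. Every vertex of \<open>B\<close> has a neighbour in each of the remaining \<open>r - b\<close> classes, so
  sparseness gives \<open>b (r - b) \<le> d r\<close>, and the low degree vertex in \<open>P\<close> forces \<open>b\<close> to be at least
  \<open>0.7982r\<close>.

  Take \<open>W\<close> in \<open>A\<close> whose removal leaves the other classes of \<open>A\<close> accessible. Counting edges between
  \<open>W\<close> and \<open>B\<close> yields \<open>w\<close> in \<open>W\<close> with more than \<open>2b - r\<close> solo neighbours, that is,
  \<open>y\<close> in \<open>B\<close> with \<open>w\<close> as only neighbour in \<open>W\<close>. Replacing \<open>w\<close> by a solo neighbour \<open>y\<close> that is not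
  adjacent to some other solo neighbour \<open>z\<close> makes the class of \<open>z\<close> accessible, which contradicts
  maximality as soon as \<open>w\<close> finds a place: in the class of \<open>y\<close> if \<open>y\<close> is its only neighbour there,
  or in a class of \<open>B\<close> without neighbours of \<open>w\<close> (at least one exists) from which, or from \<open>P\<close>, one
  can shift to the class of \<open>y\<close>. The edges forced by the failure of all these exchanges
  exceed the bound \<open>d |H|\<close>; the constant 6.21 is what makes the free class exist.
\<close>

section \<open>Numerical inequalities\<close>

text \<open>Here \<open>k\<close> and \<open>\<sigma>\<close> are the sizes of \<open>Q\<close> and
  \<open>S\<close>, and \<open>e\<close> is the count in \<open>clique_edges\<close>. If
  \<open>k\<close> reached the threshold \<open>l\<close>, then \<open>e\<close> would survive
  lowering \<open>k\<close> to \<open>l\<close>, because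
  \<open>k + l \<le> 2 * \<sigma> - 1\<close>, and then lowering \<open>\<sigma>\<close> to its
  least value.\<close>

lemma clique_bound:
  fixes r b d \<sigma> k :: real
  assumes r: "r \<ge> 1" and d: "6.21 * d \<le> r" and b: "7982/10000 * r \<le> b"
    and \<sigma>: "\<sigma> \<ge> 2 * b + 1 - r" and k: "k \<le> \<sigma>"
    and e: "k * (2 * \<sigma> - k - 1) + 2 * \<sigma> \<le> 2 * d * (\<sigma> + 1)"
  shows "k < 1925/10000 * r - 9/10"
proof (rule ccontr)
  define l where "l = 1925/10000 * r - 9/10"
  define \<delta> where "\<delta> = r * (100/621)"
  \<comment> \<open>The lower bound for \<open>\<sigma>\<close> at the least admissible
    \<open>b\<close>: \<open>2 * 0.7982 - 1 = 0.5964\<close>.\<close>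
  define \<sigma>0 where "\<sigma>0 = 5964/10000 * r + 1"
  assume "\<not> ?thesis"
  then have lk: "l \<le> k" by (simp add: l_def)
  have s2: "\<sigma>0 \<le> \<sigma>" using b \<sigma> by (simp add: \<sigma>0_def)
  have "(k - l) * (2 * \<sigma> - 1 - k - l) \<ge> 0"
    using lk k s2 r by (intro mult_nonneg_nonneg) (auto simp: l_def \<sigma>0_def)
  then have 1: "l * (2 * \<sigma> - l - 1) \<le> k * (2 * \<sigma> - k - 1)" by (simp add: algebra_simps)
  have "d * (\<sigma> + 1) \<le> \<delta> * (\<sigma> + 1)"
    using d s2 r by (intro mult_right_mono) (auto simp: \<delta>_def \<sigma>0_def)
  with 1 e have 2: "l * (2 * \<sigma> - l - 1) + 2 * \<sigma> \<le> 2 * (\<delta> * (\<sigma> + 1))" by simp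
  have "(\<sigma> - \<sigma>0) * (2 * l + 2 - 2 * \<delta>) \<ge> 0"
    using s2 r by (intro mult_nonneg_nonneg) (auto simp: l_def \<delta>_def)
  then have 3: "\<sigma> * (2 * l + 2 - 2 * \<delta>) \<ge> \<sigma>0 * (2 * l + 2 - 2 * \<delta>)"
    by (simp add: algebra_simps)
  have "\<sigma>0 * (2 * l + 2 - 2 * \<delta>) - l * l - l - 2 * \<delta> > 0"
    using r unfolding l_def \<sigma>0_def \<delta>_def
    by (simp add: field_simps, intro add_nonneg_pos mult_nonneg_nonneg, auto)
  with 2 3 show False by (simp add: algebra_simps)
qed

text \<open>The roots of \<open>b * (r - b) = r * r / 6.21\<close> are about
  \<open>0.2017 * r\<close> and \<open>0.7983 * r\<close>, so a \<open>b\<close> between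
  \<open>0.21 * r\<close> and \<open>0.7982 * r\<close> lies strictly between them and violates
  \<open>e\<close>.\<close>

lemma large_reach:
  fixes r b d :: real
  assumes r: "r \<ge> 1" and d: "6.21 * d \<le> r" and b: "21/100 * r \<le> b"
    and e: "b * (r - b) \<le> d * r"
  shows "7982/10000 * r \<le> b"
proof (rule ccontr)
  assume n: "\<not> ?thesis"
  then have "(b - 21/100 * r) * (7982/10000 * r - b) \<ge> 0"
    using b by (intro mult_nonneg_nonneg) auto
  moreover have "r * (7982/10000 * r - b) \<ge> 0" using n r by (intro mult_nonneg_nonneg) auto
  moreover have "d * r \<le> (100/621 * r) * r" using d r by (intro mult_right_mono) auto
  moreover have "r * r > 0" using r by simp
  ultimately show False using e by (simp add: field_simps)
qed

text \<open>The convex \<open>\<eta>\<close> is replaced by its chord over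
  \<open>[0.7982, 1]\<close>. Condition \<open>e\<close> leaves two ranges for \<open>y\<close>,
  near 0 and near \<open>x\<close>. The first bound on \<open>\<mu>\<close> excludes the upper
  range; in the lower one the second bound on \<open>\<mu>\<close> contradicts
  \<open>h\<close>.\<close>

lemma scaled_contradiction:
  fixes x y \<mu> \<kappa> \<epsilon> \<eta> :: real
  assumes x: "7982/10000 \<le> x" "x \<le> 1" and \<epsilon>: "\<epsilon> \<le> 1" "0 \<le> \<epsilon>" and y: "0 \<le> y"
    and \<kappa>: "\<kappa> < 1925/10000 - 9/10 * \<epsilon>"
    and \<mu>: "2 * \<mu> \<ge> 4 * x - 3 - \<kappa>" "\<mu> \<ge> 3 * x - 2 - y - \<kappa>" "\<mu> \<le> x - y"
    and \<eta>: "\<eta> = 100/621 - x + x * x"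
    and e: "(x - y) * y \<le> \<eta>"
    and h: "(\<mu> - \<epsilon>) * (x - 21/100) \<le> 2 * \<eta>"
  shows False
proof -
  \<comment> \<open>The first lower bound on \<open>\<mu>\<close> at
    \<open>\<kappa> = 0.1925\<close>; it keeps \<open>x - y\<close> away from 0.\<close>
  define c where "c = 2 * x - 159625/100000"
  have cat: "(x - 7982/10000) * (1 - x) \<ge> 0" using x by (intro mult_nonneg_nonneg) auto
  have \<eta>_le: "\<eta> \<le> 7982/10000 * x - 637168/1000000"
    using cat unfolding \<eta> by (simp add: field_simps)
  have c: "c > 0" "c \<le> x - y" using x \<mu> \<kappa> \<epsilon> by (auto simp: c_def)
  have y2: "y < x / 2"
  proof (rule ccontr)
    assume n: "\<not> ?thesis"
    then have "(x - y - c) * (y - c) \<ge> 0" using c by (intro mult_nonneg_nonneg) auto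
    then have "c * (x - c) \<le> \<eta>" using e by (simp add: algebra_simps)
    then show False using cat x unfolding c_def \<eta> by (simp add: field_simps)
  qed
  have \<eta>0: "\<eta> \<ge> 0" using y y2 x e by (smt (verit) field_sum_of_halves mult_nonneg_nonneg)
  \<comment> \<open>The factor 1.26 slightly exceeds \<open>1 / (x - g)\<close>, so
    \<open>(x - g) * g \<ge> \<eta>\<close> and the lower range of \<open>y\<close> ends before
    \<open>g\<close>.\<close>
  define g where "g = 126/100 * \<eta>"
  have g: "g < x / 2" using \<eta>_le x by (auto simp: g_def)
  have yg: "y \<le> g"
  proof (rule ccontr)
    assume n: "\<not> ?thesis"
    then have "(y - g) * (x - y - g) > 0" using y2 g by (intro mult_pos_pos) auto
    then have "(x - g) * g < \<eta>" using e by (simp add: algebra_simps)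
    moreover have "(x - g) * (126/100) \<ge> 1" using \<eta>_le x by (simp add: g_def)
    then have "(x - g) * (126/100) * \<eta> \<ge> 1 * \<eta>" using \<eta>0 by (intro mult_right_mono) auto
    moreover have "(x - g) * (126/100) * \<eta> = (x - g) * g" by (simp add: g_def)
    ultimately show False by linarith
  qed
  define L where "L = 7982/10000 * x - 637168/1000000"
  have "\<eta> \<le> L" using \<eta>_le by (simp add: L_def)
  then have "y \<le> 126/100 * L" using yg by (simp add: g_def)
  then have "3 * x - 22925/10000 - 126/100 * L \<le> \<mu> - \<epsilon>"
    using \<mu>(2) \<kappa> \<epsilon> by (simp add: field_simps)
  then have "(3 * x - 22925/10000 - 126/100 * L) * (x - 21/100) \<le> (\<mu> - \<epsilon>) * (x - 21/100)"
    using x by (intro mult_right_mono) auto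
  also have "\<dots> \<le> 2 * L" using h \<eta>_le by (simp add: L_def)
  finally have *: "(3 * x - 22925/10000 - 126/100 * L) * (x - 21/100) \<le> 2 * L" .
  \<comment> \<open>The remaining quadratic in \<open>x\<close> has a positive minimum, attained
    close to 0.88.\<close>
  have "(x - 88/100) * (x - 88/100) \<ge> 0" by simp
  with * x show False by (simp add: L_def field_simps)
qed

text \<open>The letters \<open>b\<close>, \<open>k\<close>, \<open>m\<close>, \<open>\<rho>\<close>,
  \<open>q\<close> stand for the sizes of \<open>Bc\<close>, \<open>Q\<close>, \<open>M\<close>,
  \<open>R\<close> and \<open>Bc - R\<close>. Dividing by \<open>r\<close> or its square makes the
  system scale free up to the term \<open>1 / r\<close>.\<close>

lemma final_contradiction:
  fixes r b d k m \<rho> q :: real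
  assumes r: "r \<ge> 1" and d: "6.21 * d \<le> r" and b: "7982/10000 * r \<le> b" "b \<le> r"
    and k: "k < 1925/10000 * r - 9/10"
    and m1: "2 * m \<ge> 4 * b - 3 * r - k"
    and m2: "m \<ge> 3 * b - 2 * r - q - k"
    and \<rho>: "m \<le> \<rho>" "\<rho> + q = b" "0 \<le> q" "\<rho> * q \<le> d * r - b * (r - b)"
    and h: "(m - 1) * (b - 21/100 * r) \<le> 2 * (d * r - b * (r - b))"
  shows False
proof -
  define x where "x = b / r"
  define y where "y = q / r"
  define \<eta> where "\<eta> = 100/621 - x + x * x"
  have rp: "r > 0" using r by simp
  have sc: "b = x * r" "q = y * r"
    using rp by (auto simp: x_def y_def)
  have dr: "d * r \<le> 100/621 * r * r" using d r by (intro mult_right_mono) auto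
  then have E: "d * r - b * (r - b) \<le> \<eta> * (r * r)"
    by (simp add: sc(1) \<eta>_def algebra_simps)
  have "((x - y) * y) * (r * r) \<le> \<eta> * (r * r)"
  proof -
    have "\<rho> = (x - y) * r" using \<rho>(2) sc(1,2) by (simp add: algebra_simps)
    then have "((x - y) * y) * (r * r) = \<rho> * q" by (simp add: sc(2))
    with \<rho>(4) E show ?thesis by linarith
  qed
  then have e1: "(x - y) * y \<le> \<eta>" using rp by simp
  have "((m / r - 1 / r) * (x - 21/100)) * (r * r) = (m - 1) * (b - 21/100 * r)"
    using rp by (simp add: x_def field_simps)
  then have "((m / r - 1 / r) * (x - 21/100)) * (r * r) \<le> (2 * \<eta>) * (r * r)"
    using order_trans[OF h mult_left_mono[OF E, of 2]] by (simp only: mult.assoc)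
  then have e2: "(m / r - 1 / r) * (x - 21/100) \<le> 2 * \<eta>" 
    using rp by (simp only: mult_le_cancel_right) auto
  have div: "u / r \<le> v / r" if "u \<le> v" for u v
    using that rp by (simp add: divide_right_mono)
  show False
  proof (rule scaled_contradiction[of x "1 / r" y "k / r" "m / r" \<eta>])
    show "k / r < 1925/10000 - 9/10 * (1 / r)" using k rp by (simp add: field_simps)
    show "2 * (m / r) \<ge> 4 * x - 3 - k / r"
      using div[OF m1] rp by (simp add: x_def diff_divide_distrib)
    show "m / r \<ge> 3 * x - 2 - y - k / r"
      using div[OF m2] rp by (simp add: x_def y_def diff_divide_distrib)
    have "m \<le> b - q" using \<rho>(1,2) by simp
    from div[OF this] show "m / r \<le> x - y" by (simp add: x_def y_def diff_divide_distrib)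
    show "7982/10000 \<le> x" "x \<le> 1" "0 \<le> y" "1 / r \<le> 1" "0 \<le> 1 / r"
      using b r \<rho>(3) by (auto simp: x_def y_def pos_le_divide_eq)
  qed (fact e1 e2 \<eta>_def)+
qed

section \<open>Shifting vertices between colour classes\<close>

locale vertex_colouring =
  fixes V :: "'a set" and adj :: "'a \<Rightarrow> 'a \<Rightarrow> bool" and r :: nat
  assumes finite_V: "finite V"
    and adj_sym: "adj x y \<Longrightarrow> adj y x"
    and adj_irrefl: "\<not> adj x x"
begin

definition nb :: "'a \<Rightarrow> 'a set \<Rightarrow> nat" where
  "nb x S = card {y \<in> S. adj x y}"

definition cls :: "('a \<Rightarrow> nat) \<Rightarrow> nat \<Rightarrow> 'a set" where
  "cls f i = {v \<in> V. f v = i}"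

definition proper :: "('a \<Rightarrow> nat) \<Rightarrow> bool" where
  "proper f \<longleftrightarrow> (\<forall>v\<in>V. f v < r) \<and> (\<forall>x\<in>V. \<forall>y\<in>V. adj x y \<longrightarrow> f x \<noteq> f y)"

definition free :: "('a \<Rightarrow> nat) \<Rightarrow> 'a \<Rightarrow> nat \<Rightarrow> bool" where
  "free f v i \<longleftrightarrow> (\<forall>y\<in>V. adj v y \<longrightarrow> f y \<noteq> i)"

text \<open>The vertices in \<open>F\<close> must not be moved.\<close>

definition move :: "'a set \<Rightarrow> ('a \<Rightarrow> nat) \<Rightarrow> nat \<Rightarrow> nat \<Rightarrow> bool" where
  "move F f i j \<longleftrightarrow> (\<exists>z\<in>V. z \<notin> F \<and> f z = i \<and> free f z j)"

text \<open>Paths are simple: a class is removed from \<open>K\<close> when it is left. Hence the first class of the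
  path only loses a vertex in a shift, which keeps the moves of an induction valid.\<close>

inductive path :: "'a set \<Rightarrow> ('a \<Rightarrow> nat) \<Rightarrow> nat set \<Rightarrow> nat \<Rightarrow> nat \<Rightarrow> bool" for F f where
  path_refl: "i \<in> K \<Longrightarrow> path F f K i i"
| path_step: "i \<in> K \<Longrightarrow> move F f i k \<Longrightarrow> path F f (K - {i}) k j \<Longrightarrow> path F f K i j"

text \<open>Accessible sets are built one class at a time, so that the class added last can be altered
  without destroying the accessibility of the others.\<close>

inductive acc :: "('a \<Rightarrow> nat) \<Rightarrow> nat \<Rightarrow> nat set \<Rightarrow> bool" for f s where
  acc_empty: "acc f s {}"
| acc_insert: "acc f s A \<Longrightarrow> i < r \<Longrightarrow> i \<notin> A \<Longrightarrow>
    card (cls f i) < s \<or> (\<exists>j\<in>A. move {} f i j) \<Longrightarrow> acc f s (insert i A)"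

definition balanced :: "('a \<Rightarrow> nat) \<Rightarrow> nat \<Rightarrow> bool" where
  "balanced f s \<longleftrightarrow> proper f \<and> (\<forall>i<r. card (cls f i) \<le> s \<and> s \<le> card (cls f i) + 1)"

definition near :: "('a \<Rightarrow> nat) \<Rightarrow> nat \<Rightarrow> nat \<Rightarrow> bool" where
  "near f s P \<longleftrightarrow> proper f \<and> P < r \<and> card (cls f P) = s + 1 \<and>
     (\<forall>i<r. i \<noteq> P \<longrightarrow> card (cls f i) \<le> s \<and> s \<le> card (cls f i) + 1)"

section \<open>Recolouring one or two vertices\<close>

lemma adj_commute: "adj x y \<longleftrightarrow> adj y x"
  using adj_sym by blast

lemma finite_cls [simp]: "finite (cls f i)"
  using finite_V by (simp add: cls_def)

text \<open>With the loss on the left and the gain on the right no natural subtraction occurs, the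
  case \<open>k = f z\<close> is covered, and successive recolourings combine by addition.\<close>

lemma card_cls_upd:
  assumes "z \<in> V"
  shows "card (cls (f(z := k)) l) + of_bool (l = f z) = card (cls f l) + of_bool (l = k)"
proof -
  have 1: "card (cls g l) = card (cls g l - {z}) + of_bool (l = g z)" for g
  proof (cases "l = g z")
    case True
    then have "z \<in> cls g l" using assms by (simp add: cls_def)
    then have "card (cls g l) > 0" by (metis card_gt_0_iff empty_iff finite_cls)
    with True show ?thesis using \<open>z \<in> cls g l\<close> by (simp add: card_Diff_singleton)
  next
    case False
    then show ?thesis by (simp add: cls_def)
  qed
  have "cls (f(z := k)) l - {z} = cls f l - {z}" by (auto simp: cls_def)
  then show ?thesis using 1[of f] 1[of "f(z := k)"] by simp
qed

lemma proper_upd: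
  assumes "proper f" "k < r" "free f z k" "z \<in> V"
  shows "proper (f(z := k))"
  unfolding proper_def
proof (intro conjI ballI impI)
  fix x assume "x \<in> V"
  then show "(f(z := k)) x < r" using assms by (auto simp: proper_def)
next
  fix x y assume xy: "x \<in> V" "y \<in> V" "adj x y"
  have "x \<noteq> y" using xy(3) adj_irrefl by auto
  moreover have "z = x \<Longrightarrow> f y \<noteq> k" "z = y \<Longrightarrow> f x \<noteq> k"
    using assms(3) xy adj_sym unfolding free_def by blast+
  moreover have "f x \<noteq> f y" using assms(1) xy by (simp add: proper_def)
  ultimately show "(f(z := k)) x \<noteq> (f(z := k)) y" unfolding fun_upd_apply by presburger
qed

text \<open>Both vertices leave at once, so each may have the other as a neighbour in its new
  class.\<close>

lemma proper_swap:
  assumes f: "proper f" and V: "w \<in> V" "y \<in> V" "k < r" "l < r" "k \<noteq> l"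
    and w: "\<And>z. z \<in> V \<Longrightarrow> adj w z \<Longrightarrow> f z = k \<Longrightarrow> z = y"
    and y: "\<And>z. z \<in> V \<Longrightarrow> adj y z \<Longrightarrow> f z = l \<Longrightarrow> z = w"
  shows "proper (f(w := k, y := l))"
  unfolding proper_def
proof (intro conjI ballI impI)
  fix x assume "x \<in> V"
  then show "(f(w := k, y := l)) x < r" using f V by (auto simp: proper_def)
next
  fix x z assume xz: "x \<in> V" "z \<in> V" "adj x z"
  then have "f x \<noteq> f z" "x \<noteq> z" using f adj_irrefl by (auto simp: proper_def)
  moreover have "x = w \<Longrightarrow> f z = k \<Longrightarrow> z = y" "x = y \<Longrightarrow> f z = l \<Longrightarrow> z = w"
    "z = w \<Longrightarrow> f x = k \<Longrightarrow> x = y" "z = y \<Longrightarrow> f x = l \<Longrightarrow> x = w"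
    using w y xz adj_sym by blast+
  ultimately show "(f(w := k, y := l)) x \<noteq> (f(w := k, y := l)) z"
    using V(5) unfolding fun_upd_apply by metis
qed

section \<open>Paths of moves and accessible classes\<close>

lemma path_source: "path F f K i j \<Longrightarrow> i \<in> K"
  by (erule path.cases) auto

lemma path_target: "path F f K i j \<Longrightarrow> j \<in> K"
  by (induction rule: path.induct) auto

lemma path_mono: "path F f K i j \<Longrightarrow> K \<subseteq> K' \<Longrightarrow> path F f K' i j"
proof (induction arbitrary: K' rule: path.induct)
  case (path_refl i K)
  then show ?case by (auto intro: path.path_refl)
next
  case (path_step i K k j)
  have "path F f (K' - {i}) k j" by (rule path_step.IH) (use path_step.prems in auto)
  then show ?case using path_step.hyps path_step.prems by (auto intro: path.path_step)
qed

text \<open>If the new class was already visited, the path is cut short there; so simplicity of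
  paths does not restrict reachability.\<close>

lemma path_snoc: "path F f K i j \<Longrightarrow> move F f j k \<Longrightarrow> k \<in> K \<Longrightarrow> path F f K i k"
proof (induction rule: path.induct)
  case (path_refl i K)
  then show ?case
    by (cases "k = i") (auto intro: path.path_refl path.path_step[of i K F f k k])
next
  case (path_step i K l j)
  show ?case
  proof (cases "k = i")
    case True
    then show ?thesis using path_step.hyps by (auto intro: path.path_refl)
  next
    case False
    then have "path F f (K - {i}) l k" using path_step by auto
    then show ?thesis using path_step.hyps by (auto intro: path.path_step)
  qed
qed

text \<open>If the path visits \<open>k\<close>, its part from \<open>k\<close> onwards avoids the
  source, since paths are simple.\<close>

lemma path_avoid:
  "path F f K i j \<Longrightarrow> k \<noteq> i \<Longrightarrow> path F f (K - {k}) i j \<or> path F f (K - {i}) k j"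
proof (induction rule: path.induct)
  case (path_refl i K)
  then show ?case by (auto intro: path.path_refl)
next
  case (path_step i K l j)
  show ?case
  proof (cases "k = l")
    case True
    then show ?thesis using path_step.hyps(3) by simp
  next
    case False
    from path_step.IH[OF this] show ?thesis
    proof
      assume "path F f (K - {i} - {k}) l j"
      moreover have "K - {i} - {k} = K - {k} - {i}" by auto
      ultimately have "path F f (K - {k} - {i}) l j" by simp
      then have "path F f (K - {k}) i j"
        using path_step.hyps(1,2) path_step.prems by (intro path.path_step[of i _ _ _ l]) auto
      then show ?thesis ..
    next
      assume "path F f (K - {i} - {l}) k j"
      then show ?thesis using path_mono by blast
    qed
  qed
qed

text \<open>A move survives a recolouring if its vertex keeps its colour and the class entered gains
  nothing. The source is never entered, so it may gain vertices; the target is never left, so it may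
  lose some.\<close>

lemma path_transfer:
  "path F f K i j \<Longrightarrow>
   (\<And>z. z \<in> V \<Longrightarrow> z \<notin> F \<Longrightarrow> f z \<in> K \<Longrightarrow> f z \<noteq> j \<Longrightarrow> z \<notin> F' \<and> g z = f z) \<Longrightarrow>
   (\<And>k. k \<in> K - {i} \<Longrightarrow> cls g k \<subseteq> cls f k) \<Longrightarrow> path F' g K i j"
proof (induction rule: path.induct)
  case (path_refl i K)
  then show ?case by (auto intro: path.path_refl)
next
  case (path_step i K k j)
  have j: "j \<noteq> i" and k: "k \<in> K - {i}"
    using path_target[OF path_step.hyps(3)] path_source[OF path_step.hyps(3)] by auto
  obtain z where z: "z \<in> V" "z \<notin> F" "f z = i" "free f z k"
    using path_step.hyps(2) by (auto simp: move_def)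
  have "free g z k"
    using z(4) path_step.prems(2)[OF k] by (auto simp: free_def cls_def)
  moreover have "z \<notin> F' \<and> g z = i"
    using path_step.prems(1)[OF z(1,2)] z(3) path_step.hyps(1) j by auto
  ultimately have "move F' g i k" using z(1) by (auto simp: move_def)
  moreover have "path F' g (K - {i}) k j"
    by (rule path_step.IH) (use path_step.prems in auto)
  ultimately show ?case using path_step.hyps(1) by (rule path.path_step[rotated])
qed

text \<open>The rest of the path is shifted first. Its source has then only lost vertices, so the
  vertex \<open>z\<close> leaving \<open>i\<close> can still enter it.\<close>

lemma shift_along_path:
  "path F f K i j \<Longrightarrow> proper f \<Longrightarrow> K \<subseteq> {..<r} \<Longrightarrow>
   \<exists>g. proper g \<and> (\<forall>z\<in>V. f z \<notin> K \<or> z \<in> F \<longrightarrow> g z = f z) \<and> (\<forall>z\<in>V. f z \<in> K \<longrightarrow> g z \<in> K) \<and>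
     cls g i \<subseteq> cls f i \<and>
     (\<forall>k. card (cls g k) + of_bool (k = i) = card (cls f k) + of_bool (k = j))"
proof (induction rule: path.induct)
  case (path_refl i K)
  then show ?case by (intro exI[of _ f]) auto
next
  case (path_step i K k j)
  have j: "j \<noteq> i" and k: "k \<in> K" "k \<noteq> i" "k < r"
    using path_target[OF path_step.hyps(3)] path_source[OF path_step.hyps(3)] path_step.prems(2)
    by auto
  obtain z where z: "z \<in> V" "z \<notin> F" "f z = i" "free f z k"
    using path_step.hyps(2) by (auto simp: move_def)
  obtain g where g: "proper g" "\<forall>x\<in>V. f x \<notin> K - {i} \<or> x \<in> F \<longrightarrow> g x = f x"
    "\<forall>x\<in>V. f x \<in> K - {i} \<longrightarrow> g x \<in> K - {i}" "cls g k \<subseteq> cls f k"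
    "\<And>l. card (cls g l) + of_bool (l = k) = card (cls f l) + of_bool (l = j)"
    using path_step.IH[OF path_step.prems(1)] path_step.prems(2) by blast
  have gz: "g z = i" using g(2) z by auto
  let ?h = "g(z := k)"
  have "free g z k" using z(4) g(4) by (auto simp: free_def cls_def)
  then have "proper ?h" using proper_upd g(1) k(3) z(1) by auto
  moreover have "\<forall>x\<in>V. f x \<notin> K \<or> x \<in> F \<longrightarrow> ?h x = f x"
    using g(2) z path_step.hyps(1) by auto
  moreover have "\<forall>x\<in>V. f x \<in> K \<longrightarrow> ?h x \<in> K"
    using g(2,3) k(1) by (metis Diff_iff fun_upd_apply)
  moreover have "cls ?h i \<subseteq> cls f i"
  proof
    fix x assume "x \<in> cls ?h i"
    then have "x \<in> V" "g x = i" using k(2) by (auto simp: cls_def split: if_splits)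
    then show "x \<in> cls f i" using g(2,3) by (auto simp: cls_def)
  qed
  moreover have "card (cls ?h l) + of_bool (l = i) = card (cls f l) + of_bool (l = j)" for l
    using card_cls_upd[OF z(1), of g k l] g(5)[of l] gz by simp
  ultimately show ?case by blast
qed

text \<open>Every class that is not small has a move into a class inserted earlier, so following
  moves ends in a small class.\<close>

lemma acc_path: "acc f s A \<Longrightarrow> i \<in> A \<Longrightarrow> \<exists>j\<in>A. card (cls f j) < s \<and> path {} f A i j"
proof (induction arbitrary: i rule: acc.induct)
  case (acc_insert A k)
  show ?case
  proof (cases "i \<in> A")
    case True
    then show ?thesis using acc_insert.IH[OF True] path_mono by blast
  next
    case False
    then have ik: "i = k" using acc_insert.prems by simp
    show ?thesis
    proof (cases "card (cls f k) < s")
      case True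
      then show ?thesis using ik by (auto intro: path_refl)
    next
      case False
      then obtain l where l: "l \<in> A" "move {} f k l" using acc_insert.hyps by auto
      then obtain j where j: "j \<in> A" "card (cls f j) < s" "path {} f A l j"
        using acc_insert.IH by blast
      have "insert k A - {k} = A" using acc_insert.hyps by auto
      then have "path {} f (insert k A) i j"
        using j(3) l(2) ik by (intro path_step[of i _ _ _ l]) auto
      then show ?thesis using j by auto
    qed
  qed
qed simp

lemma acc_subset: "acc f s A \<Longrightarrow> A \<subseteq> {..<r}"
  by (induction rule: acc.induct) auto

lemma move_cong:
  assumes "move {} f i j" "cls g i = cls f i" "cls g j = cls f j"
  shows "move {} g i j"
  using assms unfolding move_def free_def cls_def by blast

lemma acc_cong: "acc f s A \<Longrightarrow> (\<And>k. k \<in> A \<Longrightarrow> cls g k = cls f k) \<Longrightarrow> acc g s A"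
proof (induction rule: acc.induct)
  case (acc_insert A i)
  have "card (cls g i) < s \<or> (\<exists>j\<in>A. move {} g i j)"
    using acc_insert.hyps(4) acc_insert.prems move_cong by (metis insert_iff)
  then show ?case using acc_insert by (auto intro: acc.acc_insert)
qed (auto intro: acc_empty)

lemma acc_last:
  assumes "acc f s A" "A \<noteq> {}"
  obtains W where "W \<in> A" "acc f s (A - {W})"
    "card (cls f W) < s \<or> (\<exists>j\<in>A - {W}. move {} f W j)"
  using assms(1)
proof (cases rule: acc.cases)
  case acc_empty
  then show ?thesis using assms(2) by simp
next
  case (acc_insert A' i)
  then have "A - {i} = A'" by auto
  then show ?thesis using acc_insert that[of i] by auto
qed

lemma nb_mono: "S \<subseteq> T \<Longrightarrow> finite T \<Longrightarrow> nb x S \<le> nb x T"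
  unfolding nb_def by (intro card_mono) auto

lemma nb_disjoint_classes:
  assumes "finite I" "\<And>i. i \<in> I \<Longrightarrow> \<not> free f x i"
  shows "card I \<le> nb x {v \<in> V. f v \<in> I}"
proof -
  have "\<forall>i\<in>I. \<exists>y. y \<in> V \<and> adj x y \<and> f y = i" using assms(2) by (auto simp: free_def)
  then obtain h where h: "\<And>i. i \<in> I \<Longrightarrow> h i \<in> V \<and> adj x (h i) \<and> f (h i) = i" by metis
  have "inj_on h I" using h by (metis inj_onI)
  then have "card I = card (h ` I)" by (simp add: card_image)
  also have "\<dots> \<le> nb x {v \<in> V. f v \<in> I}"
    unfolding nb_def using h finite_V by (intro card_mono) auto
  finally show ?thesis .
qed

lemma card_preimage:
  assumes "finite I"
  shows "card {v \<in> V. f v \<in> I} = (\<Sum>i\<in>I. card (cls f i))"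
proof -
  have "{v \<in> V. f v \<in> I} = (\<Union>i\<in>I. cls f i)" by (auto simp: cls_def)
  also have "card \<dots> = (\<Sum>i\<in>I. card (cls f i))"
    using assms by (intro card_UN_disjoint) (auto simp: cls_def finite_V)
  finally show ?thesis .
qed

lemma sum_nb_swap:
  assumes "finite S" "finite T"
  shows "(\<Sum>x\<in>S. nb x T) = (\<Sum>y\<in>T. nb y S)"
proof -
  have "(\<Sum>x\<in>S. nb x T) = (\<Sum>x\<in>S. \<Sum>y | y \<in> T \<and> adj x y. 1)" by (simp add: nb_def)
  also have "\<dots> = (\<Sum>y\<in>T. \<Sum>x | x \<in> S \<and> adj x y. 1)"
    using assms by (rule sum.swap_restrict)
  also have "\<dots> = (\<Sum>y\<in>T. nb y S)"
    by (simp add: nb_def adj_commute)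
  finally show ?thesis .
qed

lemma nb_Un_disjoint:
  assumes "finite S" "finite T" "S \<inter> T = {}"
  shows "nb x (S \<union> T) = nb x S + nb x T"
proof -
  have "{y \<in> S \<union> T. adj x y} = {y \<in> S. adj x y} \<union> {y \<in> T. adj x y}" by auto
  then show ?thesis unfolding nb_def using assms by (subst card_Un_disjoint[symmetric]) auto
qed

lemma card_cls_swap:
  assumes "w \<in> V" "y \<in> V" "w \<noteq> y"
  shows "card (cls (f(w := k, y := f w)) l) + of_bool (l = f y) = card (cls f l) + of_bool (l = k)"
  using card_cls_upd[OF assms(2), of "f(w := k)" "f w" l] card_cls_upd[OF assms(1), of f k l] assms(3)
  by simp

end

section \<open>Extremal colourings\<close>

text \<open>The sum in \<open>sparse\<close> counts each edge of the subgraph induced by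
  \<open>X\<close> twice, hence the factor 2.\<close>

locale sparse_graph = vertex_colouring V adj r
  for V :: "'a set" and adj and r +
  fixes d :: real
  assumes r_ge_1: "1 \<le> r"
    and d_nonneg: "0 \<le> d"
    and d_le: "6.21 * d \<le> real r"
    and degree_le: "x \<in> V \<Longrightarrow> nb x V \<le> r"
    and sparse: "X \<subseteq> V \<Longrightarrow> real (\<Sum>x\<in>X. nb x X) \<le> 2 * d * real (card X)"

text \<open>The setting of a proof by contradiction. The maximum ranges over all large classes and
  light vertices, because an exchange may make another class the large one.\<close>

locale extremal = sparse_graph V adj r d
  for V :: "'a set" and adj r d +
  fixes f :: "'a \<Rightarrow> nat" and s P :: nat and u :: 'a and A :: "nat set"
  assumes card_V: "card V \<le> r * s"
    and near: "near f s P"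
    and u: "u \<in> cls f P"
    and light_u: "real (nb u V) \<le> 79/100 * real r"
    and acc: "acc f s A"
    and no_balanced: "\<not> balanced g s"
    and maximal: "near g s Q \<Longrightarrow> x \<in> cls g Q \<Longrightarrow> real (nb x V) \<le> 79/100 * real r \<Longrightarrow>
      acc g s A' \<Longrightarrow> card A' \<le> card A"
begin

text \<open>\<open>Bc\<close> are the classes reachable from the large class \<open>P\<close>, and \<open>BV\<close> is their union.\<close>

definition K :: "nat set" where "K = {..<r} - A"

definition Bc :: "nat set" where "Bc = {j. path {} f K P j}"

definition BV :: "'a set" where "BV = {v \<in> V. f v \<in> Bc}"

lemma f_proper: "proper f" and P_less: "P < r" and card_P: "card (cls f P) = s + 1"
  and card_other: "i < r \<Longrightarrow> i \<noteq> P \<Longrightarrow> card (cls f i) \<le> s \<and> s \<le> card (cls f i) + 1"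
  using near by (auto simp: near_def)

lemma f_less: "v \<in> V \<Longrightarrow> f v < r"
  using f_proper by (auto simp: proper_def)

lemma A_subset: "A \<subseteq> {..<r}" and finite_A: "finite A"
  using acc_subset[OF acc] finite_subset by auto

lemma K_subset: "K \<subseteq> {..<r}" and K_A: "k \<in> K \<Longrightarrow> k \<notin> A"
  by (auto simp: K_def)

lemma acc_insert_max:
  assumes "i < r" "card (cls f i) < s \<or> (\<exists>j\<in>A. move {} f i j)"
  shows "i \<in> A"
proof (rule ccontr)
  assume i: "i \<notin> A"
  then have "acc f s (insert i A)" using acc assms by (intro acc_insert)
  from maximal[OF near u light_u this] show False using i finite_A by simp
qed

lemma card_ge_notin_A: "i < r \<Longrightarrow> i \<notin> A \<Longrightarrow> s \<le> card (cls f i)"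
  using acc_insert_max[of i] by force

lemma not_free_A: "x \<in> V \<Longrightarrow> f x \<notin> A \<Longrightarrow> j \<in> A \<Longrightarrow> \<not> free f x j"
  using acc_insert_max[of "f x"] f_less by (auto simp: move_def)

text \<open>Shifting from \<open>P\<close> into a small class would balance the colouring.\<close>

lemma P_notin_A: "P \<notin> A"
proof
  assume "P \<in> A"
  then obtain j where j: "j \<in> A" "card (cls f j) < s" "path {} f A P j"
    using acc_path[OF acc] by blast
  obtain g where g: "proper g"
    "\<And>k. card (cls g k) + of_bool (k = P) = card (cls f k) + of_bool (k = j)"
    using shift_along_path[OF j(3) f_proper A_subset] by blast
  have "card (cls g i) \<le> s \<and> s \<le> card (cls g i) + 1" if "i < r" for i
    using g(2)[of i] card_P card_other[OF that] j(2) by (cases "i = P"; cases "i = j") auto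
  with g(1) have "balanced g s" by (auto simp: balanced_def)
  then show False using no_balanced by blast
qed

lemma P_in_K: "P \<in> K"
  using P_notin_A P_less by (simp add: K_def)

lemma P_in_Bc: "P \<in> Bc"
  using P_in_K by (auto simp: Bc_def intro: path_refl)

lemma Bc_subset: "Bc \<subseteq> K"
  using path_target by (auto simp: Bc_def)

lemma finite_Bc: "finite Bc"
  using finite_subset[OF subset_trans[OF Bc_subset K_subset]] by simp

text \<open>A move into \<open>A\<close> would make the class of \<open>x\<close> accessible, and a
  move into another class of \<open>K\<close> would extend a path from \<open>P\<close>.\<close>

lemma not_free_Bc:
  assumes "x \<in> V" "f x \<in> Bc" "j < r" "j \<notin> Bc"
  shows "\<not> free f x j"
proof
  assume x: "free f x j"
  have xA: "f x \<notin> A" using assms(2) Bc_subset K_A by auto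
  then have "j \<in> K" using not_free_A[OF assms(1)] x assms(3) by (auto simp: K_def)
  moreover have "move {} f (f x) j" using assms(1) x by (auto simp: move_def)
  ultimately have "j \<in> Bc" using assms(2) path_snoc unfolding Bc_def by blast
  with assms(4) show False by simp
qed

lemma card_cls_Bc: "i \<in> Bc \<Longrightarrow> i \<noteq> P \<Longrightarrow> card (cls f i) = s"
  using card_ge_notin_A[of i] card_other[of i] Bc_subset K_def by force

lemma finite_BV: "finite BV" and BV_subset: "BV \<subseteq> V"
  using finite_V by (auto simp: BV_def)

lemma u_in: "u \<in> V" "f u = P" "u \<in> BV"
  using u P_in_Bc by (auto simp: cls_def BV_def)

lemma card_classes_Bc:
  assumes "I \<subseteq> Bc"
  shows "card {v \<in> V. f v \<in> I} = card I * s + of_bool (P \<in> I)"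
proof -
  have fin: "finite I" using assms finite_Bc finite_subset by auto
  have "card {v \<in> V. f v \<in> I} = (\<Sum>i\<in>I. s + of_bool (i = P))"
    unfolding card_preimage[OF fin]
    by (intro sum.cong) (use assms card_cls_Bc card_P in auto)
  also have "\<dots> = card I * s + of_bool (P \<in> I)"
    using fin by (simp add: sum.distrib of_bool_def sum.delta)
  finally show ?thesis .
qed

lemma card_BV: "card BV = card Bc * s + 1"
  using card_classes_Bc[of Bc] P_in_Bc by (simp add: BV_def)

text \<open>Otherwise every class has at least \<open>s\<close> vertices and \<open>P\<close> has
  one more, which exceeds \<open>r * s\<close>.\<close>

lemma A_nonempty: "A \<noteq> {}"
proof
  assume A: "A = {}"
  have "r * s < (\<Sum>i<r. card (cls f i))"
  proof -
    have "(\<Sum>i<r. s) < (\<Sum>i<r. card (cls f i))"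
      by (rule sum_strict_mono_ex1) (use A card_ge_notin_A card_P P_less in force)+
    then show ?thesis by simp
  qed
  also have "\<dots> = card {v \<in> V. f v \<in> {..<r}}" by (simp only: card_preimage[OF finite_lessThan])
  also have "\<dots> \<le> card V" using finite_V by (intro card_mono) auto
  finally show False using card_V by simp
qed

lemma card_Bc_le: "card Bc \<le> r"
proof -
  have "card Bc \<le> card {..<r}" using Bc_subset K_subset by (intro card_mono) auto
  then show ?thesis by simp
qed

lemma nb_outside:
  assumes "y \<in> BV"
  shows "r - card Bc \<le> nb y (V - BV)"
proof -
  have "card ({..<r} - Bc) \<le> nb y {v \<in> V. f v \<in> {..<r} - Bc}"
    using assms not_free_Bc by (intro nb_disjoint_classes) (auto simp: BV_def)
  also have "{v \<in> V. f v \<in> {..<r} - Bc} = V - BV" using f_less by (auto simp: BV_def)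
  also have "card ({..<r} - Bc) = r - card Bc"
    using Bc_subset K_subset finite_Bc by (subst card_Diff_subset) auto
  finally show ?thesis .
qed

lemma nb_split: "nb y V = nb y BV + nb y (V - BV)"
proof -
  have "V = BV \<union> (V - BV)" using BV_subset by auto
  then show ?thesis using nb_Un_disjoint[of BV "V - BV" y] finite_BV finite_V by auto
qed

text \<open>Edges leaving \<open>BV\<close> are counted from both ends, hence twice; edges outside
  \<open>BV\<close> are dropped.\<close>

lemma total_edges:
  "real (\<Sum>y\<in>BV. nb y BV) + 2 * real (\<Sum>y\<in>BV. nb y (V - BV)) \<le> 2 * d * real r * real s"
proof -
  have "(\<Sum>x\<in>V. nb x V) = (\<Sum>x\<in>BV. nb x V) + (\<Sum>x\<in>V - BV. nb x V)"
    using finite_V BV_subset by (simp add: sum.subset_diff add.commute)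
  also have "\<dots> = (\<Sum>x\<in>BV. nb x BV) + (\<Sum>x\<in>BV. nb x (V - BV)) +
      ((\<Sum>x\<in>V - BV. nb x BV) + (\<Sum>x\<in>V - BV. nb x (V - BV)))"
    by (simp add: nb_split sum.distrib)
  also have "(\<Sum>x\<in>V - BV. nb x BV) = (\<Sum>x\<in>BV. nb x (V - BV))"
    using sum_nb_swap finite_V finite_BV by simp
  finally have "(\<Sum>y\<in>BV. nb y BV) + 2 * (\<Sum>y\<in>BV. nb y (V - BV)) \<le> (\<Sum>x\<in>V. nb x V)" by simp
  from order_trans[OF of_nat_mono[OF this, where 'a = real] sparse[OF subset_refl]]
  have "real ((\<Sum>y\<in>BV. nb y BV) + 2 * (\<Sum>y\<in>BV. nb y (V - BV))) \<le> 2 * d * real (card V)" .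
  also have "\<dots> \<le> 2 * d * real (r * s)"
    using card_V d_nonneg by (intro mult_left_mono) (auto simp del: of_nat_mult)
  finally show ?thesis by simp
qed

lemma outside_edges: "card BV * (r - card Bc) \<le> (\<Sum>y\<in>BV. nb y (V - BV))"
proof -
  have "card BV * (r - card Bc) = (\<Sum>y\<in>BV. r - card Bc)" by simp
  also have "\<dots> \<le> (\<Sum>y\<in>BV. nb y (V - BV))" using nb_outside by (intro sum_mono)
  finally show ?thesis .
qed

end

section \<open>Exchanging a vertex with its solo neighbours\<close>

locale extremal_vertex = extremal V adj r d f s P u A
  for V :: "'a set" and adj r d f s P u A +
  fixes W :: nat and w :: 'a
  assumes W: "W \<in> A" and acc_W: "acc f s (A - {W})"
    and W_move: "card (cls f W) < s \<or> (\<exists>j\<in>A - {W}. move {} f W j)"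
    and w: "w \<in> cls f W"
begin

text \<open>\<open>S\<close> are the solo neighbours of \<open>w\<close>, and \<open>N\<close> the others.\<close>

definition S :: "'a set" where "S = {y \<in> BV. adj w y \<and> nb y (cls f W) = 1}"

definition N :: "'a set" where "N = {y \<in> BV. adj w y \<and> nb y (cls f W) \<noteq> 1}"

lemma w_in: "w \<in> V" "f w = W"
  using w by (auto simp: cls_def)

lemma W_less: "W < r"
  using W A_subset by auto

lemma W_notin_K: "W \<notin> K"
  using W by (auto simp: K_def)

lemma S_D: "y \<in> S \<Longrightarrow> y \<in> V \<and> f y \<in> Bc \<and> f y \<in> K \<and> f y \<noteq> W \<and> y \<noteq> w \<and> adj w y"
  using Bc_subset W_notin_K w_in by (auto simp: S_def BV_def)

lemma S_unique:
  assumes "y \<in> S" "z \<in> V" "adj y z" "f z = W"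
  shows "z = w"
proof -
  obtain a where a: "{x \<in> cls f W. adj y x} = {a}"
    using assms(1) by (auto simp: S_def nb_def card_1_singleton_iff)
  have "w \<in> {a}" unfolding a[symmetric] using assms(1) w adj_sym by (auto simp: S_def)
  moreover have "z \<in> {a}" unfolding a[symmetric] using assms by (auto simp: cls_def)
  ultimately show ?thesis by simp
qed

lemma proper_exchange:
  assumes "y \<in> S" "j < r" "j \<noteq> W" "\<And>z. z \<in> V \<Longrightarrow> adj w z \<Longrightarrow> f z = j \<Longrightarrow> z = y"
  shows "proper (f(w := j, y := W))"
proof (rule proper_swap[OF f_proper w_in(1) _ assms(2) W_less assms(3)])
  show "y \<in> V" using S_D[OF assms(1)] by blast
qed (fact assms(4) S_unique[OF assms(1)])+

lemma card_exchange:
  assumes "y \<in> S"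
  shows "card (cls (f(w := j, y := W)) l) + of_bool (l = f y) = card (cls f l) + of_bool (l = j)"
  using card_cls_swap[of w y f j l] S_D[OF assms] w_in by auto

text \<open>Otherwise moving \<open>w\<close> inside the accessible classes makes room for \<open>y\<close>, and a shift
  along a path out of the large class completes a balanced colouring.\<close>

lemma w_stuck:
  assumes y: "y \<in> S" and j: "j \<in> A - {W}"
  shows "\<not> free f w j"
proof
  assume wj: "free f w j"
  note yD = S_D[OF y]
  let ?g = "f(w := j, y := W)"
  have jK: "j \<notin> K" "j < r" using j A_subset by (auto simp: K_def)
  have g: "proper ?g" using proper_exchange[OF y] wj j jK by (auto simp: free_def)
  have "path {} f K P (f y)" using yD by (simp add: Bc_def)
  then have "path {} ?g K P (f y)"
  proof (rule path_transfer)
    fix z assume "z \<in> V" "f z \<in> K" "f z \<noteq> f y"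
    then show "z \<notin> {} \<and> ?g z = f z" using w_in W_notin_K by auto
  next
    fix k assume "k \<in> K - {P}"
    then show "cls ?g k \<subseteq> cls f k" using jK W_notin_K by (auto simp: cls_def split: if_splits)
  qed
  from shift_along_path[OF this g K_subset] obtain g1 where g1: "proper g1"
    "\<forall>z\<in>V. ?g z \<notin> K \<longrightarrow> g1 z = ?g z" "\<forall>z\<in>V. ?g z \<in> K \<longrightarrow> g1 z \<in> K"
    "\<And>k. card (cls g1 k) + of_bool (k = P) = card (cls ?g k) + of_bool (k = f y)" by blast
  \<comment> \<open>This second shift stays in \<open>A - {W}\<close>, which is disjoint from
    \<open>K\<close>, so it does not interfere with the shift out of \<open>P\<close>.\<close>
  obtain Z where Z: "Z \<in> A - {W}" "card (cls f Z) < s" "path {} f (A - {W}) j Z"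
    using acc_path[OF acc_W j] by blast
  have "path {} g1 (A - {W}) j Z" using Z(3)
  proof (rule path_transfer)
    fix z assume z: "z \<in> V" "f z \<in> A - {W}"
    then have "?g z = f z" "f z \<notin> K" using w_in yD by (auto simp: K_def)
    then show "z \<notin> {} \<and> g1 z = f z" using g1(2) z(1) by auto
  next
    fix k assume k: "k \<in> A - {W} - {j}"
    show "cls g1 k \<subseteq> cls f k"
    proof
      fix v assume "v \<in> cls g1 k"
      then have v: "v \<in> V" "g1 v = k" by (auto simp: cls_def)
      have "k \<notin> K" using k by (auto simp: K_def)
      then have "?g v = k" using g1(2,3) v by metis
      then show "v \<in> cls f k" using v(1) k by (auto simp: cls_def split: if_splits)
    qed
  qed
  from shift_along_path[OF this g1(1)] A_subset obtain g2 where g2: "proper g2"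
    "\<And>k. card (cls g2 k) + of_bool (k = j) = card (cls g1 k) + of_bool (k = Z)" by blast
  have eq: "card (cls g2 k) + of_bool (k = P) = card (cls f k) + of_bool (k = Z)" for k
    using g2(2)[of k] g1(4)[of k] card_exchange[OF y, of j k] by linarith
  have "Z \<noteq> P" using Z(1) P_notin_A by auto
  then have "card (cls g2 i) \<le> s \<and> s \<le> card (cls g2 i) + 1" if "i < r" for i
    using eq[of i] card_P card_other[OF that] Z(2) by (cases "i = P"; cases "i = Z") auto
  with g2(1) have "balanced g2 s" by (auto simp: balanced_def)
  then show False using no_balanced by blast
qed

text \<open>Under \<open>g\<close> all of \<open>A\<close> stays accessible. The vertex
  \<open>y2\<close> has lost its only neighbour \<open>w\<close> in \<open>W\<close> and is not
  adjacent to the newcomer \<open>y\<close>, so it can move into \<open>W\<close> and its class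
  joins \<open>A\<close>, against maximality.\<close>

lemma enlarge_acc:
  assumes g: "near g s Q" "x \<in> cls g Q" "real (nb x V) \<le> 79/100 * real r"
    and A: "\<And>z. z \<in> V \<Longrightarrow> f z \<in> A \<Longrightarrow> z \<noteq> w \<Longrightarrow> g z = f z"
      "\<And>z. z \<in> V \<Longrightarrow> f z \<notin> A \<Longrightarrow> z \<noteq> y \<Longrightarrow> g z \<in> K" "g w \<in> K" "g y = W"
    and y: "y \<in> S" and y2: "y2 \<in> S" "y2 \<noteq> y" "\<not> adj y y2"
  shows False
proof -
  note yD = S_D[OF y]
  note y2D = S_D[OF y2(1)]
  have same: "cls g k = cls f k" if "k \<in> A - {W}" for k
  proof -
    have "g z = k \<longleftrightarrow> f z = k" if "z \<in> V" for z
      using A \<open>k \<in> A - {W}\<close> that w_in yD K_A by (metis DiffE insertI1)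
    then show ?thesis by (auto simp: cls_def)
  qed
  have clsW: "cls g W = insert y (cls f W - {w})"
  proof -
    have "z \<in> V \<Longrightarrow> g z = W \<longleftrightarrow> z = y \<or> f z = W \<and> z \<noteq> w" for z
      using A W W_notin_K w_in yD by metis
    then show ?thesis using yD by (auto simp: cls_def)
  qed
  have "acc g s (A - {W})" using acc_W same by (rule acc_cong)
  moreover have "card (cls g W) < s \<or> (\<exists>j\<in>A - {W}. move {} g W j)"
    using W_move
  proof
    assume *: "card (cls f W) < s"
    have "y \<notin> cls f W" using yD by (auto simp: cls_def)
    then have "card (cls g W) = card (cls f W)"
      unfolding clsW using card_Suc_Diff1[OF finite_cls w] by simp
    then show ?thesis using * by simp
  next
    assume "\<exists>j\<in>A - {W}. move {} f W j"
    then obtain j z where jz: "j \<in> A - {W}" "z \<in> V" "f z = W" "free f z j"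
      by (auto simp: move_def)
    \<comment> \<open>The vertex that made \<open>W\<close> accessible is not \<open>w\<close>, so
      it is still in \<open>W\<close>.\<close>
    have "z \<noteq> w" using w_stuck[OF y jz(1)] jz(4) by auto
    then have "g z = W" using A(1) jz W by auto
    moreover have "free g z j" using jz(4) same[OF jz(1)] by (auto simp: free_def cls_def)
    ultimately show ?thesis using jz by (auto simp: move_def)
  qed
  ultimately have "acc g s (insert W (A - {W}))"
    using W_less by (intro acc_insert) auto
  then have accg: "acc g s A" using W by (simp add: insert_absorb)
  have gy2: "g y2 \<in> K" using A(2) y2D y2(2) K_A by auto
  have "free g y2 W"
    unfolding free_def
  proof (intro ballI impI notI)
    fix z assume z: "z \<in> V" "adj y2 z" "g z = W"
    then have "z \<in> insert y (cls f W - {w})" unfolding clsW[symmetric] by (simp add: cls_def)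
    moreover have "z \<noteq> y" using z(2) y2(3) adj_commute by blast
    ultimately show False using S_unique[OF y2(1) z(1,2)] by (simp add: cls_def)
  qed
  then have "move {} g (g y2) W" using y2D by (auto simp: move_def)
  then have "acc g s (insert (g y2) A)"
    using accg gy2 K_subset W K_A by (intro acc_insert) auto
  from maximal[OF g this] show False using K_A[OF gy2] finite_A by simp
qed

text \<open>Otherwise \<open>w\<close> and \<open>y\<close> trade classes. All sizes are kept, and
  \<open>y \<noteq> u\<close> leaves the light vertex in \<open>P\<close>.\<close>

lemma unique_neighbour_adjacent:
  assumes y: "y \<in> S" "y \<noteq> u" and y2: "y2 \<in> S" "y2 \<noteq> y"
    and uniq: "\<And>z. z \<in> V \<Longrightarrow> adj w z \<Longrightarrow> f z = f y \<Longrightarrow> z = y"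
  shows "adj y y2"
proof (rule ccontr)
  assume "\<not> adj y y2"
  note yD = S_D[OF y(1)]
  let ?g = "f(w := f y, y := W)"
  have "proper ?g" using proper_exchange[OF y(1)] yD uniq K_subset by auto
  moreover have "card (cls ?g l) = card (cls f l)" for l using card_exchange[OF y(1), of "f y" l] by simp
  ultimately have near: "near ?g s P" using near by (simp add: near_def)
  have "u \<noteq> w" using u_in w_in P_notin_A W by auto
  then have "u \<in> cls ?g P" using u y(2) by (auto simp: cls_def)
  from near this light_u show False
  proof (rule enlarge_acc[OF _ _ _ _ _ _ _ y(1) y2 \<open>\<not> adj y y2\<close>])
    fix z assume "z \<in> V" "f z \<in> A" "z \<noteq> w"
    then show "?g z = f z" using yD K_A by auto
  next
    fix z assume "z \<in> V" "f z \<notin> A" "z \<noteq> y"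
    then show "?g z \<in> K" using yD f_less by (auto simp: K_def)
  qed (use yD in auto)
qed

text \<open>Otherwise \<open>w\<close> goes to \<open>Y\<close>, \<open>y\<close> goes to
  \<open>W\<close>, and a shift from \<open>Y\<close> to the old class of \<open>y\<close> restores
  all sizes. Since \<open>u\<close> is not moved, \<open>P\<close> keeps a light vertex.\<close>

lemma no_path_from_free_class:
  assumes Y: "Y \<in> Bc" "free f w Y" and y: "y \<in> S" "y \<noteq> u"
    and y2: "y2 \<in> S" "y2 \<noteq> y" "\<not> adj y y2"
  shows "\<not> path {u} f K Y (f y)"
proof
  assume path: "path {u} f K Y (f y)"
  note yD = S_D[OF y(1)]
  let ?g = "f(w := Y, y := W)"
  have YK: "Y \<in> K" "Y < r" "Y \<noteq> W" using Y Bc_subset K_subset W_notin_K by auto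
  have uw: "u \<noteq> w" using u_in w_in P_notin_A W by auto
  have g: "proper ?g" using proper_exchange[OF y(1)] Y YK by (auto simp: free_def)
  have "path {u} ?g K Y (f y)" using path
  proof (rule path_transfer)
    fix z assume "z \<in> V" "z \<notin> {u}" "f z \<in> K" "f z \<noteq> f y"
    then show "z \<notin> {u} \<and> ?g z = f z" using w_in W_notin_K by auto
  next
    fix k assume "k \<in> K - {Y}"
    then show "cls ?g k \<subseteq> cls f k" using W_notin_K by (auto simp: cls_def split: if_splits)
  qed
  from shift_along_path[OF this g K_subset] obtain h where h: "proper h"
    "\<forall>z\<in>V. ?g z \<notin> K \<or> z \<in> {u} \<longrightarrow> h z = ?g z" "\<forall>z\<in>V. ?g z \<in> K \<longrightarrow> h z \<in> K"
    "\<And>k. card (cls h k) + of_bool (k = Y) = card (cls ?g k) + of_bool (k = f y)" by blast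
  have "card (cls h k) = card (cls f k)" for k
    using h(4)[of k] card_exchange[OF y(1), of Y k] by linarith
  then have near: "near h s P" using near h(1) by (simp add: near_def)
  have "h u = P" using h(2) u_in uw y(2) by auto
  then have "u \<in> cls h P" using u_in by (auto simp: cls_def)
  from near this light_u show False
  proof (rule enlarge_acc[OF _ _ _ _ _ _ _ y(1) y2])
    fix z assume z: "z \<in> V" "f z \<in> A" "z \<noteq> w"
    then have "?g z = f z" "f z \<notin> K" using yD K_A by auto
    then show "h z = f z" using h(2) z(1) by auto
  next
    fix z assume z: "z \<in> V" "f z \<notin> A" "z \<noteq> y"
    then have "?g z \<in> K" using f_less YK by (auto simp: K_def)
    then show "h z \<in> K" using h(3) z(1) by auto
  next
    have "?g w \<in> K" using YK yD by auto
    then show "h w \<in> K" using h(3) w_in by auto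
    show "h y = W" using h(2) yD W_notin_K by auto
  qed
qed

text \<open>Here \<open>w\<close> moves to \<open>Y\<close> and \<open>P\<close> is shifted to the class of \<open>y\<close>, so that \<open>Y\<close> becomes the large
  class; a light vertex in \<open>Y\<close> would make the new colouring a competitor.\<close>

lemma no_light_free_class:
  assumes Y: "Y \<in> Bc" "Y \<noteq> P" "free f w Y" and y: "y \<in> S" "y \<noteq> u"
    and y2: "y2 \<in> S" "y2 \<noteq> y" "\<not> adj y y2"
    and x: "x \<in> cls f Y"
  shows "79/100 * real r < real (nb x V)"
proof (rule ccontr)
  assume light: "\<not> ?thesis"
  note yD = S_D[OF y(1)]
  note y2D = S_D[OF y2(1)]
  let ?g = "f(w := Y, y := W)"
  let ?K = "K - {Y}"
  have YK: "Y \<in> K" "Y < r" "Y \<noteq> W" using Y Bc_subset K_subset W_notin_K by auto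
  have "path {} f K P (f y)" using yD by (simp add: Bc_def)
  \<comment> \<open>A path through \<open>Y\<close> would contain one from \<open>Y\<close> that
    avoids \<open>P\<close> and hence does not move \<open>u\<close>, which is already excluded.
    Avoiding \<open>Y\<close> keeps both \<open>w\<close> and \<open>x\<close> there during the
    shift.\<close>
  from path_avoid[OF this Y(2)] have path: "path {} f ?K P (f y)"
  proof
    assume "path {} f (K - {P}) Y (f y)"
    then have "path {u} f (K - {P}) Y (f y)"
      by (rule path_transfer) (use u_in in auto)
    then have "path {u} f K Y (f y)" by (rule path_mono) auto
    then show ?thesis using no_path_from_free_class[OF Y(1,3) y y2] by blast
  qed
  have g: "proper ?g" using proper_exchange[OF y(1)] Y YK by (auto simp: free_def)
  have "path {} ?g ?K P (f y)" using path
  proof (rule path_transfer)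
    fix z assume "z \<in> V" "f z \<in> ?K" "f z \<noteq> f y"
    then show "z \<notin> {} \<and> ?g z = f z" using w_in W_notin_K by auto
  next
    fix k assume "k \<in> ?K - {P}"
    then show "cls ?g k \<subseteq> cls f k" using W_notin_K by (auto simp: cls_def split: if_splits)
  qed
  from shift_along_path[OF this g] K_subset obtain h where h: "proper h"
    "\<forall>z\<in>V. ?g z \<notin> ?K \<longrightarrow> h z = ?g z" "\<forall>z\<in>V. ?g z \<in> ?K \<longrightarrow> h z \<in> ?K"
    "\<And>k. card (cls h k) + of_bool (k = P) = card (cls ?g k) + of_bool (k = f y)" by blast
  have eq: "card (cls h k) + of_bool (k = P) = card (cls f k) + of_bool (k = Y)" for k
    using h(4)[of k] card_exchange[OF y(1), of Y k] by linarith
  have near: "near h s Y"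
    unfolding near_def
  proof (intro conjI allI impI)
    show "card (cls h Y) = s + 1" using eq[of Y] Y card_cls_Bc by simp
    fix i assume "i < r" "i \<noteq> Y"
    then show "card (cls h i) \<le> s" "s \<le> card (cls h i) + 1"
      using eq[of i] card_P card_other[of i] by (cases "i = P"; simp)+
  qed (use h(1) YK in auto)
  have "x \<noteq> w" "x \<noteq> y" using x w_in YK Y(3) yD by (auto simp: cls_def free_def)
  then have "h x = Y" using h(2) x by (auto simp: cls_def)
  then have "x \<in> cls h Y" using x by (auto simp: cls_def)
  from near this show False
  proof (rule enlarge_acc[OF _ _ _ _ _ _ _ y(1) y2])
    fix z assume z: "z \<in> V" "f z \<in> A" "z \<noteq> w"
    then have "?g z = f z" "f z \<notin> K" using yD K_A by auto
    then show "h z = f z" using h(2) z(1) by auto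
  next
    fix z assume z: "z \<in> V" "f z \<notin> A" "z \<noteq> y"
    then have "?g z \<in> K" using f_less YK by (auto simp: K_def)
    then show "h z \<in> K" using h(2,3) z(1) by (metis Diff_iff)
  next
    have "?g w = Y" using yD by auto
    then show "h w \<in> K" using h(2) w_in YK by auto
    show "h y = W" using h(2) yD W_notin_K by auto
  qed (use light in auto)
qed

end

section \<open>Counting edges\<close>

context extremal_vertex
begin

text \<open>The solo neighbours that no exchange can use, for want of a nonadjacent partner. The
  vertex \<open>u\<close> is left out since the exchanges must not move it.\<close>

definition Q :: "'a set" where "Q = {y \<in> S - {u}. \<forall>z\<in>S. z \<noteq> y \<longrightarrow> adj y z}"

definition M :: "nat set" where "M = {i \<in> Bc. free f w i}"

definition R :: "nat set" where "R = {j \<in> Bc. \<exists>Y\<in>M. path {u} f K Y j}"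

lemma subsets: "S \<subseteq> BV" "N \<subseteq> BV" "Q \<subseteq> S" "insert u Q \<subseteq> BV" "M \<subseteq> R" "R \<subseteq> Bc"
proof -
  show "S \<subseteq> BV" "N \<subseteq> BV" "Q \<subseteq> S" "insert u Q \<subseteq> BV" "R \<subseteq> Bc"
    using u_in by (auto simp: S_def N_def Q_def R_def)
  show "M \<subseteq> R" using Bc_subset by (auto simp: M_def R_def intro: path_refl)
qed

lemma finites: "finite S" "finite N" "finite Q" "finite M" "finite R"
  using finite_subset[OF _ finite_BV] finite_subset[OF _ finite_Bc] subsets by (auto simp: M_def)

lemma card_S_N: "card S + card N \<le> r"
proof -
  have "card S + card N = card (S \<union> N)"
    using finites by (intro card_Un_disjoint[symmetric]) (auto simp: S_def N_def)
  also have "\<dots> \<le> nb w V"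
    unfolding nb_def using finite_V BV_subset by (intro card_mono) (auto simp: S_def N_def)
  also have "\<dots> \<le> r" using degree_le w_in by auto
  finally show ?thesis .
qed

lemma sum_card_classes:
  assumes "T \<subseteq> BV"
  shows "(\<Sum>i\<in>Bc. card (T \<inter> cls f i)) = card T"
proof -
  have "T = (\<Union>i\<in>Bc. T \<inter> cls f i)" using assms by (auto simp: BV_def cls_def)
  then have "card T = card (\<Union>i\<in>Bc. T \<inter> cls f i)" by simp
  also have "\<dots> = (\<Sum>i\<in>Bc. card (T \<inter> cls f i))"
    using finite_Bc by (intro card_UN_disjoint) (auto simp: cls_def finite_V)
  finally show ?thesis ..
qed

lemma card_insert_Q: "card (insert u Q) = card Q + 1"
  using finites by (simp add: Q_def)

lemma hit_cases:
  assumes "i \<in> Bc - M"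
  obtains y where "y \<in> V" "f y = i" "adj w y" "y \<in> S \<or> y \<in> N"
  using assms by (auto simp: M_def free_def S_def N_def BV_def)

lemma card_pos: "y \<in> T \<Longrightarrow> y \<in> V \<Longrightarrow> f y = i \<Longrightarrow> 1 \<le> card (T \<inter> cls f i)"
  by (metis (mono_tags, lifting) One_nat_def Suc_leI card_gt_0_iff cls_def empty_iff finite_Int finite_cls IntI mem_Collect_eq)

text \<open>Each class where \<open>w\<close> has a neighbour receives weight at least 2: a
  neighbour in \<open>N\<close> gives 2, two solo neighbours give 1 each, and a solo neighbour that
  is alone lies in \<open>insert u Q\<close> and counts once more there.\<close>

lemma hit_count:
  "2 * card (Bc - M) \<le> card S + 2 * card N + card Q + 1"
proof -
  let ?c = "\<lambda>i. card (S \<inter> cls f i) + 2 * card (N \<inter> cls f i) + card (insert u Q \<inter> cls f i)"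
  have "2 \<le> ?c i" if i: "i \<in> Bc - M" for i
  proof -
    obtain y where y: "y \<in> V" "f y = i" "adj w y" "y \<in> S \<or> y \<in> N" using hit_cases[OF i] .
    show ?thesis
    proof (cases "N \<inter> cls f i = {}")
      case False
      then have "1 \<le> card (N \<inter> cls f i)" by (simp add: Suc_le_eq card_gt_0_iff)
      then show ?thesis by linarith
    next
      case True
      then have yS: "y \<in> S" using y by (auto simp: cls_def)
      show ?thesis
      proof (cases "\<exists>z\<in>V. z \<noteq> y \<and> adj w z \<and> f z = i")
        case True
        then obtain z where z: "z \<in> V" "z \<noteq> y" "adj w z" "f z = i" by blast
        have "z \<in> S" using z \<open>N \<inter> cls f i = {}\<close> i by (auto simp: S_def N_def BV_def cls_def)
        then have "card {y, z} \<le> card (S \<inter> cls f i)"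
          using z y yS finites(1) by (intro card_mono) (auto simp: cls_def)
        then show ?thesis using z(2) by simp
      next
        case False
        have "y \<in> insert u Q"
        proof (cases "y = u")
          case False
          then have "adj y z" if "z \<in> S" "z \<noteq> y" for z
            using unique_neighbour_adjacent[OF yS False that] \<open>\<not> (\<exists>z\<in>V. z \<noteq> y \<and> adj w z \<and> f z = i)\<close> y(2)
            by blast
          with False yS show ?thesis by (auto simp: Q_def)
        qed simp
        then have "1 \<le> card (insert u Q \<inter> cls f i)" "1 \<le> card (S \<inter> cls f i)"
          using card_pos y yS by auto
        then show ?thesis by linarith
      qed
    qed
  qed
  then have "(\<Sum>i\<in>Bc - M. 2) \<le> (\<Sum>i\<in>Bc - M. ?c i)" by (rule sum_mono)
  also have "\<dots> \<le> (\<Sum>i\<in>Bc. ?c i)" using finite_Bc by (intro sum_mono2) auto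
  also have "\<dots> = card S + 2 * card N + card (insert u Q)"
    using subsets by (simp add: sum.distrib sum_card_classes flip: sum_distrib_left)
  finally show ?thesis using card_insert_Q by simp
qed

text \<open>A solo neighbour in a class of \<open>R\<close> must lie in \<open>insert u Q\<close>,
  since any other one would admit the exchange along a path from a class of
  \<open>M\<close>.\<close>

lemma hit_count_R:
  "card (Bc - M) \<le> card (Bc - R) + card N + card Q + 1"
proof -
  let ?c = "\<lambda>i. of_bool (i \<in> Bc - R) + card (N \<inter> cls f i) + card (insert u Q \<inter> cls f i)"
  have "1 \<le> ?c i" if i: "i \<in> Bc - M" for i
  proof -
    obtain y where y: "y \<in> V" "f y = i" "adj w y" "y \<in> S \<or> y \<in> N" using hit_cases[OF i] .
    show ?thesis
    proof (cases "i \<in> R \<and> y \<in> S")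
      case True
      have "y \<in> insert u Q"
      proof (rule ccontr)
        assume n: "y \<notin> insert u Q"
        then obtain z where "z \<in> S" "z \<noteq> y" "\<not> adj y z" using True by (auto simp: Q_def)
        moreover obtain Y where "Y \<in> Bc" "free f w Y" "path {u} f K Y (f y)"
          using True y(2) by (auto simp: R_def M_def)
        ultimately show False using no_path_from_free_class[of Y y z] n True by auto
      qed
      then have "1 \<le> card (insert u Q \<inter> cls f i)" using card_pos y by auto
      then show ?thesis by linarith
    next
      case False
      then show ?thesis using y(4) card_pos[OF _ y(1,2), of N] i by force
    qed
  qed
  then have "(\<Sum>i\<in>Bc - M. 1) \<le> (\<Sum>i\<in>Bc - M. ?c i)" by (rule sum_mono)
  also have "\<dots> \<le> (\<Sum>i\<in>Bc. ?c i)" using finite_Bc by (intro sum_mono2) auto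
  also have "\<dots> = (\<Sum>i\<in>Bc. of_bool (i \<in> Bc - R)) + card N + card (insert u Q)"
    using subsets by (simp add: sum.distrib sum_card_classes)
  also have "(\<Sum>i\<in>Bc. of_bool (i \<in> Bc - R)) = card (Bc - R)"
  proof -
    have "Bc \<inter> {i. i \<notin> R} = Bc - R" by auto
    then show ?thesis using finite_Bc by (simp add: of_bool_def sum.If_cases)
  qed
  finally show ?thesis using card_insert_Q by simp
qed

text \<open>Degrees are summed in the graph induced by \<open>insert w S\<close>: \<open>w\<close>
  is joined to all of \<open>S\<close>, and each vertex of \<open>Q\<close> to all the rest of
  \<open>S\<close>.\<close>

lemma clique_edges:
  "real (card Q) * (2 * real (card S) - real (card Q) - 1) + 2 * real (card S)
    \<le> 2 * d * (real (card S) + 1)"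
proof -
  let ?X = "insert w S"
  have wS: "w \<notin> S" using S_D by blast
  have Q: "nb x S \<ge> card S - 1" if "x \<in> Q" for x
  proof -
    have "card (S - {x}) \<le> nb x S"
      unfolding nb_def using that finites by (intro card_mono) (auto simp: Q_def)
    then show ?thesis using that subsets(3) by (auto simp: card_Diff_singleton subset_iff)
  qed
  have SQ: "nb x S \<ge> card Q" if "x \<in> S - Q" for x
    unfolding nb_def
  proof (intro card_mono subsetI)
    fix y assume y: "y \<in> Q"
    then have "y \<in> S" "y \<noteq> x" using that subsets(3) by auto
    moreover have "x \<in> S" using that by simp
    then have "adj y x" using y \<open>y \<noteq> x\<close> by (auto simp: Q_def)
    ultimately show "y \<in> {y \<in> S. adj x y}" using adj_sym by blast
  qed (use finites in simp)
  have "nb w ?X \<ge> card S"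
    unfolding nb_def using finites by (intro card_mono) (auto simp: S_def)
  moreover have "nb x ?X \<ge> nb x S + 1" if "x \<in> S" for x
  proof -
    have "nb x ?X = nb x {w} + nb x S"
      using nb_Un_disjoint[of "{w}" S x] finites wS by simp
    moreover have "{y. y = w \<and> adj x y} = {w}" using that adj_commute by (auto simp: S_def)
    ultimately show ?thesis by (simp add: nb_def)
  qed
  then have "(\<Sum>x\<in>S. nb x S + 1) \<le> (\<Sum>x\<in>S. nb x ?X)" by (rule sum_mono)
  then have "(\<Sum>x\<in>S. nb x S) + card S \<le> (\<Sum>x\<in>S. nb x ?X)" unfolding sum.distrib by simp
  moreover have "(\<Sum>x\<in>S. nb x S) = (\<Sum>x\<in>Q. nb x S) + (\<Sum>x\<in>S - Q. nb x S)"
    using finites subsets(3) by (simp add: sum.subset_diff add.commute)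
  moreover have "card Q * (card S - 1) \<le> (\<Sum>x\<in>Q. nb x S)"
    using sum_mono[of Q "\<lambda>_. card S - 1" "\<lambda>x. nb x S"] Q by simp
  moreover have "card (S - Q) * card Q \<le> (\<Sum>x\<in>S - Q. nb x S)"
    using sum_mono[of "S - Q" "\<lambda>_. card Q" "\<lambda>x. nb x S"] SQ by simp
  ultimately have "card Q * (card S - 1) + card (S - Q) * card Q + 2 * card S \<le> (\<Sum>x\<in>?X. nb x ?X)"
    using finites wS by simp
  then have "real (card Q * (card S - 1) + card (S - Q) * card Q + 2 * card S) \<le> real (\<Sum>x\<in>?X. nb x ?X)"
    by (rule of_nat_mono)
  also have "\<dots> \<le> 2 * d * real (card ?X)"
    using sparse subsets(1) BV_subset w_in by auto
  also have "real (card ?X) = real (card S) + 1" using finites wS by simp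
  also have "real (card Q * (card S - 1) + card (S - Q) * card Q + 2 * card S) =
     real (card Q) * (2 * real (card S) - real (card Q) - 1) + 2 * real (card S)"
  \<comment> \<open>The truncated difference \<open>card S - 1\<close> is correct only for nonempty
    \<open>S\<close>.\<close>
  proof (cases "card S = 0")
    case True
    then show ?thesis using finites subsets(3) by (auto simp: card_eq_0_iff)
  next
    case False
    then have 1: "real (card S - 1) = real (card S) - 1" by (simp add: of_nat_diff)
    have 2: "real (card (S - Q)) = real (card S) - real (card Q)"
      using finites subsets(3) by (simp add: card_Diff_subset card_mono of_nat_diff)
    show ?thesis unfolding of_nat_add of_nat_mult 1 2 by (simp add: algebra_simps)
  qed
  finally show ?thesis .
qed

text \<open>A vertex other than \<open>u\<close> in a class of \<open>R\<close> has a neighbour in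
  every class of \<open>Bc - R\<close>, as otherwise it would extend a path that fixes
  \<open>u\<close>. Each such edge counts at both ends.\<close>

lemma R_edges: "2 * (card R * s * card (Bc - R)) \<le> (\<Sum>y\<in>BV. nb y BV)"
proof -
  let ?X = "{v \<in> V. f v \<in> R} - {u}" and ?Y = "{v \<in> V. f v \<in> Bc - R}"
  have fin: "finite ?X" "finite ?Y" using finite_V by auto
  have XY: "?X \<inter> ?Y = {}" "?X \<union> ?Y \<subseteq> BV" using subsets(6) by (auto simp: BV_def)
  have "card R * s \<le> card ?X"
  \<comment> \<open>Leaving out \<open>u\<close> costs a vertex only if \<open>P\<close> is in
    \<open>R\<close>, and then the extra vertex of \<open>P\<close> makes up for it.\<close>
  proof (cases "P \<in> R")
    case True
    then have "u \<in> {v \<in> V. f v \<in> R}" using u_in by simp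
    then show ?thesis using card_classes_Bc[OF subsets(6)] True by (simp add: card_Diff_singleton)
  next
    case False
    then have "?X = {v \<in> V. f v \<in> R}" using u_in by auto
    then show ?thesis using card_classes_Bc[OF subsets(6)] by simp
  qed
  then have "card R * s * card (Bc - R) \<le> card ?X * card (Bc - R)" by (rule mult_right_mono) simp
  also have "\<dots> = (\<Sum>x\<in>?X. card (Bc - R))" by simp
  also have "\<dots> \<le> (\<Sum>x\<in>?X. nb x ?Y)"
  proof (rule sum_mono)
    fix x assume x: "x \<in> ?X"
    have "\<not> free f x i" if i: "i \<in> Bc - R" for i
    proof
      assume "free f x i"
      then have "move {u} f (f x) i" using x by (auto simp: move_def)
      moreover obtain Y where "Y \<in> M" "path {u} f K Y (f x)" using x by (auto simp: R_def)
      ultimately have "path {u} f K Y i" using i Bc_subset path_snoc by blast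
      then show False using i \<open>Y \<in> M\<close> by (auto simp: R_def)
    qed
    then show "card (Bc - R) \<le> nb x ?Y" using finite_Bc by (intro nb_disjoint_classes) auto
  qed
  finally have 1: "card R * s * card (Bc - R) \<le> (\<Sum>x\<in>?X. nb x ?Y)" .
  have "(\<Sum>x\<in>?X. nb x ?Y) + (\<Sum>x\<in>?X. nb x ?Y) = (\<Sum>x\<in>?X. nb x ?Y) + (\<Sum>y\<in>?Y. nb y ?X)"
    using sum_nb_swap[OF fin] by simp
  also have "\<dots> \<le> (\<Sum>x\<in>?X. nb x BV) + (\<Sum>y\<in>?Y. nb y BV)"
    using XY(2) finite_BV by (intro add_mono sum_mono nb_mono) auto
  also have "\<dots> = (\<Sum>x\<in>?X \<union> ?Y. nb x BV)" by (rule sum.union_disjoint[OF fin XY(1), symmetric])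
  also have "\<dots> \<le> (\<Sum>x\<in>BV. nb x BV)" using XY(2) finite_BV by (intro sum_mono2) auto
  finally show ?thesis using 1 by linarith
qed

end

section \<open>Edge budget and a vertex with many solo neighbours\<close>

context extremal
begin

text \<open>The forced edges leaving \<open>BV\<close> use up part of the total. The remainder
  bounds the degree sum inside \<open>BV\<close>, and also the excess of the full degrees over the
  forced \<open>r - card Bc\<close>.\<close>

lemma budget:
  "real (\<Sum>y\<in>BV. nb y BV) + 2 * (real (card Bc) * (real r - real (card Bc)) * real s)
    \<le> 2 * d * real r * real s" (is ?th1)
  and budget_excess:
  "real (\<Sum>y\<in>BV. nb y V) - real (card BV) * (real r - real (card Bc))
    \<le> 2 * (d * real r - real (card Bc) * (real r - real (card Bc))) * real s" (is ?th2)
proof -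
  define b e c where "b = real (card Bc)" and "e = real (\<Sum>y\<in>BV. nb y BV)"
    and "c = real (\<Sum>y\<in>BV. nb y (V - BV))"
  have tot: "e + 2 * c \<le> 2 * d * real r * real s" using total_edges by (simp add: e_def c_def)
  have br: "real (r - card Bc) = real r - b" "0 \<le> real r - b"
    using card_Bc_le by (auto simp: b_def of_nat_diff)
  have "real (card BV * (r - card Bc)) \<le> c" unfolding c_def using outside_edges by (rule of_nat_mono)
  then have c: "real (card BV) * (real r - b) \<le> c" using br by simp
  have "b * real s \<le> real (card BV)" by (simp add: card_BV b_def)
  then have "b * real s * (real r - b) \<le> real (card BV) * (real r - b)"
    using br by (intro mult_right_mono)
  then have c2: "b * (real r - b) * real s \<le> real (card BV) * (real r - b)" by (simp add: mult_ac)
  show ?th1 using tot c c2 unfolding b_def[symmetric] e_def[symmetric] by linarith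
  have "real (\<Sum>y\<in>BV. nb y V) = e + c" by (simp add: nb_split e_def c_def sum.distrib)
  moreover have "2 * (d * real r - b * (real r - b)) * real s = 2 * d * real r * real s - 2 * (b * (real r - b) * real s)"
    by (simp add: algebra_simps)
  ultimately show ?th2 using tot c c2 unfolding b_def[symmetric] by linarith
qed

text \<open>The light vertex \<open>u\<close> is blocked in at most \<open>0.79 * r\<close> classes;
  every class where it is free is reachable from \<open>P\<close>.\<close>

lemma reach_lower: "21/100 * real r \<le> real (card Bc)"
proof -
  let ?I = "{i. i < r \<and> \<not> free f u i}"
  have "card ?I \<le> nb u {v \<in> V. f v \<in> ?I}" by (intro nb_disjoint_classes) auto
  also have "\<dots> \<le> nb u V" using finite_V by (intro nb_mono) auto
  finally have "card ?I \<le> nb u V" .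
  moreover have "{..<r} \<subseteq> ?I \<union> Bc"
    using not_free_Bc[OF u_in(1)] u_in(2) P_in_Bc by auto
  then have "card {..<r} \<le> card (?I \<union> Bc)" using finite_Bc by (intro card_mono) auto
  then have "r \<le> card ?I + card Bc" using card_Un_le[of ?I Bc] by simp
  ultimately have "real r \<le> real (nb u V) + real (card Bc)" by linarith
  then show ?thesis using light_u by linarith
qed

text \<open>An edge from \<open>W\<close> to \<open>y\<close> weighs 2 if \<open>y\<close> has no
  other neighbour in \<open>W\<close>, and 1 otherwise. Each \<open>y\<close> in \<open>BV\<close>
  then receives at least 2, in total more than \<open>2 * s * card Bc\<close>, while
  \<open>W\<close> has at most \<open>s\<close> vertices.\<close>

lemma exists_solo_rich_vertex:
  assumes "W \<in> A"
  shows "\<exists>w\<in>cls f W. 2 * card Bc + 1 \<le> 2 * card {y \<in> BV. adj w y \<and> nb y (cls f W) = 1}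
    + card {y \<in> BV. adj w y \<and> nb y (cls f W) \<noteq> 1}"
proof (rule ccontr)
  let ?g = "\<lambda>w. 2 * card {y \<in> BV. adj w y \<and> nb y (cls f W) = 1}
    + card {y \<in> BV. adj w y \<and> nb y (cls f W) \<noteq> 1}"
  let ?h = "\<lambda>y. if nb y (cls f W) = 1 then 2 else (1::nat)"
  assume n: "\<not> ?thesis"
  have Wr: "W < r" "W \<noteq> P" using assms A_subset P_notin_A by auto
  have eq: "?g w = (\<Sum>y | y \<in> BV \<and> adj w y. ?h y)" for w
  proof -
    have fin: "finite {y \<in> BV. adj w y}" using finite_BV by simp
    have "(\<Sum>y | y \<in> BV \<and> adj w y. ?h y) =
       2 * card ({y \<in> BV. adj w y} \<inter> {y. nb y (cls f W) = 1}) +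
       card ({y \<in> BV. adj w y} \<inter> - {y. nb y (cls f W) = 1})"
      using sum.If_cases[OF fin, of "\<lambda>y. nb y (cls f W) = 1" "\<lambda>_. 2::nat" "\<lambda>_. 1"] by simp
    also have "{y \<in> BV. adj w y} \<inter> {y. nb y (cls f W) = 1} =
       {y \<in> BV. adj w y \<and> nb y (cls f W) = 1}" by auto
    also have "{y \<in> BV. adj w y} \<inter> - {y. nb y (cls f W) = 1} =
       {y \<in> BV. adj w y \<and> nb y (cls f W) \<noteq> 1}" by auto
    finally show ?thesis ..
  qed
  have "2 * card BV = (\<Sum>y\<in>BV. 2)" by simp
  also have "\<dots> \<le> (\<Sum>y\<in>BV. nb y (cls f W) * ?h y)"
  proof (rule sum_mono)
    fix y assume y: "y \<in> BV"
    have "W \<notin> Bc" using assms Bc_subset K_A by auto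
    then have "\<not> free f y W" using y not_free_Bc Wr by (auto simp: BV_def)
    then obtain x where "x \<in> {x \<in> cls f W. adj y x}" by (auto simp: free_def cls_def)
    then have "nb y (cls f W) \<noteq> 0" unfolding nb_def by (subst card_0_eq) auto
    then show "2 \<le> nb y (cls f W) * ?h y" by auto
  qed
  also have "\<dots> = (\<Sum>y\<in>BV. \<Sum>w | w \<in> cls f W \<and> adj y w. ?h y)" by (simp add: nb_def)
  also have "\<dots> = (\<Sum>w\<in>cls f W. \<Sum>y | y \<in> BV \<and> adj y w. ?h y)"
    using finite_BV by (intro sum.swap_restrict) auto
  also have "\<dots> = (\<Sum>w\<in>cls f W. ?g w)" 
  proof (rule sum.cong[OF refl])
    fix w
    have "{y. y \<in> BV \<and> adj y w} = {y. y \<in> BV \<and> adj w y}" using adj_commute by blast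
    then show "(\<Sum>y | y \<in> BV \<and> adj y w. ?h y) = ?g w" unfolding eq by simp
  qed
  also have "\<dots> \<le> (\<Sum>w\<in>cls f W. 2 * card Bc)"
  proof (rule sum_mono)
    fix w assume "w \<in> cls f W"
    with n have "\<not> 2 * card Bc + 1 \<le> ?g w" by blast
    then show "?g w \<le> 2 * card Bc" by linarith
  qed
  also have "\<dots> = card (cls f W) * (2 * card Bc)" by simp
  also have "\<dots> \<le> s * (2 * card Bc)" using card_other[OF Wr] by (intro mult_right_mono) auto
  finally show False by (simp add: card_BV)
qed

end

context extremal_vertex
begin

lemma s_pos: "0 < s"
proof -
  have "0 < card (cls f W)" using w by (auto simp: card_gt_0_iff)
  moreover have "W \<noteq> P" using W P_notin_A by auto
  ultimately show ?thesis using card_other[OF W_less] by auto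
qed

text \<open>The free classes other than \<open>P\<close> consist of vertices of degree above
  \<open>0.79 * r\<close>, which exceeds the forced \<open>r - card Bc\<close>;
  \<open>budget_excess\<close> limits the total excess.\<close>

lemma heavy_bound:
  assumes y: "y \<in> S" "y \<noteq> u" "z \<in> S" "z \<noteq> y" "\<not> adj y z"
  shows "(real (card M) - 1) * (real (card Bc) - 21/100 * real r)
    \<le> 2 * (d * real r - real (card Bc) * (real r - real (card Bc)))"
proof -
  let ?H = "{v \<in> V. f v \<in> M - {P}}"
  define b where "b = real (card Bc)"
  have MB: "M - {P} \<subseteq> Bc" by (auto simp: M_def)
  have H: "?H \<subseteq> BV" using MB by (auto simp: BV_def)
  have b0: "0 \<le> b - 21/100 * real r" using reach_lower by (simp add: b_def)
  have "card M \<le> card (M - {P}) + 1" by (auto simp: card_Diff_singleton_if)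
  then have "real (card M) - 1 \<le> real (card (M - {P}))" by linarith
  then have "(real (card M) - 1) * real s \<le> real (card (M - {P})) * real s"
    by (intro mult_right_mono) auto
  also have "\<dots> = real (card ?H)" using card_classes_Bc[OF MB] by simp
  finally have "(real (card M) - 1) * real s * (b - 21/100 * real r)
      \<le> real (card ?H) * (b - 21/100 * real r)" using b0 by (rule mult_right_mono)
  also have "\<dots> = (\<Sum>x\<in>?H. b - 21/100 * real r)" by simp
  also have "\<dots> \<le> (\<Sum>x\<in>?H. real (nb x V) - (real r - b))"
  proof (rule sum_mono)
    fix x assume x: "x \<in> ?H"
    then have "79/100 * real r < real (nb x V)"
      using no_light_free_class[of "f x" y z x] y by (auto simp: M_def cls_def)
    then show "b - 21/100 * real r \<le> real (nb x V) - (real r - b)" by linarith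
  qed
  also have "\<dots> \<le> (\<Sum>x\<in>BV. real (nb x V) - (real r - b))"
  proof (rule sum_mono2[OF finite_BV H])
    fix x assume "x \<in> BV - ?H"
    then have "r - card Bc \<le> nb x V" using nb_outside[of x] nb_split[of x] by auto
    then show "0 \<le> real (nb x V) - (real r - b)" by (simp add: b_def)
  qed
  also have "\<dots> = real (\<Sum>y\<in>BV. nb y V) - real (card BV) * (real r - b)"
    by (simp add: sum_subtractf)
  also have "\<dots> \<le> 2 * (d * real r - b * (real r - b)) * real s"
    using budget_excess by (simp add: b_def)
  finally have "((real (card M) - 1) * (b - 21/100 * real r)) * real s
    \<le> (2 * (d * real r - b * (real r - b))) * real s" by (simp only: mult_ac)
  then show ?thesis using s_pos by (simp add: b_def)
qed

lemma no_solo_rich_vertex: "\<not> 2 * card Bc + 1 \<le> 2 * card S + card N"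
proof
  assume rich: "2 * card Bc + 1 \<le> 2 * card S + card N"
  define b \<sigma> k where "b = real (card Bc)" and "\<sigma> = real (card S)" and "k = real (card Q)"
  define m \<rho> q where "m = real (card M)" and "\<rho> = real (card R)" and "q = real (card (Bc - R))"
  have sp: "0 < real s" using s_pos by simp
  have r1: "1 \<le> real r" using r_ge_1 by simp
  have rich': "2 * b + 1 \<le> 2 * \<sigma> + real (card N)" "\<sigma> + real (card N) \<le> real r"
    using rich card_S_N by (auto simp: b_def \<sigma>_def)
  have br: "b \<le> real r" using card_Bc_le by (simp add: b_def)
  have bud: "real (\<Sum>y\<in>BV. nb y BV) \<le> (2 * (d * real r - b * (real r - b))) * real s"
    using budget by (simp add: b_def algebra_simps)
  have "0 \<le> real (\<Sum>y\<in>BV. nb y BV)" by (rule of_nat_0_le_iff)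
  then have "0 \<le> (2 * (d * real r - b * (real r - b))) * real s" using bud by linarith
  then have "b * (real r - b) \<le> d * real r" using sp by (simp add: zero_le_mult_iff)
  then have big: "7982/10000 * real r \<le> b"
    using large_reach[OF r1 d_le] reach_lower by (simp add: b_def)
  have kS: "k \<le> \<sigma>" using card_mono[OF finites(1) subsets(3)] by (simp add: k_def \<sigma>_def)
  have \<sigma>: "\<sigma> \<ge> 2 * b + 1 - real r" using rich' by linarith
  have k: "k < 1925/10000 * real r - 9/10"
    using clique_bound[OF r1 d_le big \<sigma> kS] clique_edges by (simp add: k_def \<sigma>_def)
  \<comment> \<open>\<open>Q\<close> is too small to contain almost all of \<open>S\<close>, so some
    solo neighbour other than \<open>u\<close> has a nonadjacent partner.\<close>
  have "\<not> S \<subseteq> insert u Q"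
  proof
    assume "S \<subseteq> insert u Q"
    then have "card S \<le> card (insert u Q)" using finites by (intro card_mono) auto
    then have "\<sigma> \<le> k + 1" using card_insert_Q by (simp add: \<sigma>_def k_def)
    then show False using k \<sigma> big r1 by linarith
  qed
  then obtain y z where yz: "y \<in> S" "y \<noteq> u" "z \<in> S" "z \<noteq> y" "\<not> adj y z"
    by (auto simp: Q_def)
  have hM: "real (card (Bc - M)) = b - m" and hR: "q = b - \<rho>"
    using finites finite_Bc subsets(5,6)
    by (auto simp: b_def m_def q_def \<rho>_def card_Diff_subset card_mono of_nat_diff)
  have "real (2 * card (Bc - M)) \<le> real (card S + 2 * card N + card Q + 1)"
    using hit_count by (rule of_nat_mono)
  \<comment> \<open>With \<open>n = card N\<close>, the bounds in \<open>rich'\<close> give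
    \<open>\<sigma> + 2 * n \<le> 2 * r - \<sigma> \<le> 3 * r - 2 * b - 1\<close>.\<close>
  then have m1: "2 * m \<ge> 4 * b - 3 * real r - k"
    using hM rich' by (simp add: \<sigma>_def k_def)
  have "real (card (Bc - M)) \<le> real (card (Bc - R) + card N + card Q + 1)"
    using hit_count_R by (rule of_nat_mono)
  \<comment> \<open>Here \<open>n \<le> r - \<sigma> \<le> 2 * r - 2 * b - 1\<close> is
    used.\<close>
  then have m2: "m \<ge> 3 * b - 2 * real r - q - k"
    using hM rich' by (simp add: q_def k_def)
  have \<rho>: "m \<le> \<rho>" "\<rho> + q = b" "0 \<le> q"
    using card_mono[OF finites(5) subsets(5)] hR by (auto simp: m_def \<rho>_def q_def)
  have "real (2 * (card R * s * card (Bc - R))) \<le> real (\<Sum>y\<in>BV. nb y BV)"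
    using R_edges by (rule of_nat_mono)
  then have "(2 * (\<rho> * q)) * real s \<le> (2 * (d * real r - b * (real r - b))) * real s"
    using bud by (simp add: \<rho>_def q_def mult_ac)
  then have "\<rho> * q \<le> d * real r - b * (real r - b)" using sp by simp
  from final_contradiction[OF r1 d_le big br k m1 m2 \<rho> this] heavy_bound[OF yz]
  show False by (simp add: m_def b_def)
qed

end

lemma (in extremal) contradiction: False
proof -
  obtain W where W: "W \<in> A" "acc f s (A - {W})"
    "card (cls f W) < s \<or> (\<exists>j\<in>A - {W}. move {} f W j)"
    using acc_last[OF acc A_nonempty] by blast
  obtain w where w_cls: "w \<in> cls f W" and
    rich: "2 * card Bc + 1 \<le> 2 * card {y \<in> BV. adj w y \<and> nb y (cls f W) = 1}
      + card {y \<in> BV. adj w y \<and> nb y (cls f W) \<noteq> 1}"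
    using exists_solo_rich_vertex[OF W(1)] by blast
  interpret extremal_vertex V adj r d f s P u A W w
    by unfold_locales (use W w_cls in auto)
  show False using no_solo_rich_vertex rich by (simp add: S_def N_def)
qed

section \<open>Equitable colourings of sparse graphs\<close>

context sparse_graph
begin

text \<open>A maximal accessible set exists because these sets lie in \<open>{..<r}\<close> and the
  empty set is accessible.\<close>

lemma near_imp_balanced:
  assumes "near f s P" "u \<in> cls f P" "real (nb u V) \<le> 79/100 * real r" "card V \<le> r * s"
  shows "\<exists>g. balanced g s"
proof (rule ccontr)
  assume no: "\<not> ?thesis"
  define config where "config = (\<lambda>(g, Q, x, A). near g s Q \<and> x \<in> cls g Q \<and>
      real (nb x V) \<le> 79/100 * real r \<and> acc g s A)"
  have "config (f, P, u, {})" using assms acc_empty by (simp add: config_def)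
  moreover have "\<forall>c. config c \<longrightarrow> card (snd (snd (snd c))) < r + 1"
  proof (intro allI impI)
    fix c assume "config c"
    then have "snd (snd (snd c)) \<subseteq> {..<r}" by (auto simp: config_def dest!: acc_subset)
    then have "card (snd (snd (snd c))) \<le> card {..<r}" by (intro card_mono) auto
    then show "card (snd (snd (snd c))) < r + 1" by simp
  qed
  ultimately obtain c where c: "config c"
    "\<forall>c'. config c' \<longrightarrow> card (snd (snd (snd c'))) \<le> card (snd (snd (snd c)))"
    using ex_has_greatest_nat[of config _ "\<lambda>c. card (snd (snd (snd c)))" "r + 1"] by blast
  obtain g Q x A where cc: "c = (g, Q, x, A)" by (cases c)
  interpret extremal V adj r d g s Q x A
  proof unfold_locales
    fix g' Q' x' A'
    assume "near g' s Q'" "x' \<in> cls g' Q'" "real (nb x' V) \<le> 79/100 * real r" "acc g' s A'"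
    then have "config (g', Q', x', A')" by (simp add: config_def)
    then show "card A' \<le> card A" using c(2) cc by fastforce
  qed (use assms(4) no c(1) cc in \<open>auto simp: config_def\<close>)
  show False by (rule contradiction)
qed

text \<open>The average degree is at most \<open>2 * d\<close>, which is below
  \<open>0.33 * r\<close>.\<close>

lemma exists_light_vertex:
  assumes "V \<noteq> {}"
  obtains v where "v \<in> V" "real (nb v V) \<le> 79/100 * real r"
proof -
  have "\<exists>v\<in>V. real (nb v V) \<le> 2 * d"
  proof (rule ccontr)
    assume "\<not> ?thesis"
    then have "(\<Sum>v\<in>V. 2 * d) < (\<Sum>v\<in>V. real (nb v V))"
      using assms finite_V by (intro sum_strict_mono) auto
    then show False using sparse[OF subset_refl] by (simp add: mult_ac)
  qed
  then obtain v where v: "v \<in> V" "real (nb v V) \<le> 2 * d" by blast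
  have "2 * d \<le> 79/100 * real r" using d_le r_ge_1 by simp
  with v show ?thesis by (intro that[of v]) auto
qed

text \<open>With fewer than \<open>r\<close> neighbours, \<open>v\<close> finds a free class. If
  that class overflows, \<open>v\<close> itself is the light vertex in the large class.\<close>

lemma extend_colouring:
  assumes v: "v \<in> V" "real (nb v V) \<le> 79/100 * real r" and card_V: "card V \<le> r * s"
    and f: "\<And>x. x \<in> V - {v} \<Longrightarrow> f x < r"
      "\<And>x y. x \<in> V - {v} \<Longrightarrow> y \<in> V - {v} \<Longrightarrow> adj x y \<Longrightarrow> f x \<noteq> f y"
      "\<And>i. i < r \<Longrightarrow> card {x \<in> V - {v}. f x = i} \<le> s \<and> s \<le> card {x \<in> V - {v}. f x = i} + 1"
  shows "\<exists>g. balanced g s"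
proof -
  have "\<exists>i<r. free f v i"
  proof (rule ccontr)
    assume "\<not> ?thesis"
    then have "card {..<r} \<le> nb v {x \<in> V. f x \<in> {..<r}}"
      by (intro nb_disjoint_classes) auto
    also have "\<dots> \<le> nb v V" using finite_V by (intro nb_mono) auto
    finally show False using v(2) r_ge_1 by simp
  qed
  then obtain i where i: "i < r" "free f v i" by blast
  let ?g = "f(v := i)"
  have g: "proper ?g"
    unfolding proper_def
  proof (intro conjI ballI impI)
    fix x assume "x \<in> V" then show "?g x < r" using f(1) i(1) by auto
  next
    fix x y assume xy: "x \<in> V" "y \<in> V" "adj x y"
    then have "x \<noteq> y" "adj y x" using adj_irrefl adj_sym by auto
    then show "?g x \<noteq> ?g y" using xy f(2) i(2) by (auto simp: free_def)
  qed
  have card: "card (cls ?g j) = card {x \<in> V - {v}. f x = j} + of_bool (j = i)" for j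
  proof (cases "j = i")
    case True
    then have "cls ?g j = insert v {x \<in> V - {v}. f x = j}" using v(1) by (auto simp: cls_def)
    then show ?thesis using True finite_V by simp
  next
    case False
    then have "cls ?g j = {x \<in> V - {v}. f x = j}" by (auto simp: cls_def)
    then show ?thesis using False by simp
  qed
  show ?thesis
  proof (cases "card {x \<in> V - {v}. f x = i} < s")
    case True
    then have "card (cls ?g j) \<le> s \<and> s \<le> card (cls ?g j) + 1" if "j < r" for j
      using f(3)[OF that] card[of j] by (cases "j = i") auto
    then have "balanced ?g s" using g by (auto simp: balanced_def)
    then show ?thesis by blast
  next
    case False
    then have "card (cls ?g i) = s + 1" using card[of i] f(3)[OF i(1)] by simp
    then have "near ?g s i" using g i(1) card f(3) by (auto simp: near_def)
    moreover have "v \<in> cls ?g i" using v(1) by (simp add: cls_def)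
    ultimately show ?thesis using near_imp_balanced v(2) card_V by blast
  qed
qed

lemma sparse_graph_subset:
  assumes "X \<subseteq> V"
  shows "sparse_graph X adj r d"
proof -
  have fin: "finite X" using assms finite_V finite_subset by auto
  interpret X: vertex_colouring X adj r
    by unfold_locales (use fin adj_sym adj_irrefl in auto)
  show ?thesis
  proof unfold_locales
    fix x assume "x \<in> X"
    then show "nb x X \<le> r"
      using degree_le[of x] nb_mono[OF assms finite_V, of x] assms by auto
  next
    fix Y assume "Y \<subseteq> X"
    then show "real (\<Sum>x\<in>Y. nb x Y) \<le> 2 * d * real (card Y)"
      using sparse assms by auto
  qed (use r_ge_1 d_nonneg d_le in auto)
qed

end

text \<open>A class larger than \<open>t + 1\<close> forces all classes to at least
  \<open>t + 1\<close>, and one smaller than \<open>t\<close> forces all to at most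
  \<open>t\<close>; either contradicts the total.\<close>

lemma equitable_sizes:
  fixes c :: "nat \<Rightarrow> nat"
  assumes c: "\<And>i j. i < r \<Longrightarrow> j < r \<Longrightarrow> c i \<le> c j + 1"
    and lo: "r * t \<le> (\<Sum>i<r. c i)" and hi: "(\<Sum>i<r. c i) < r * (t + 1)" and i: "i < r"
  shows "c i \<le> t + 1 \<and> t + 1 \<le> c i + 1"
proof (intro conjI)
  show "c i \<le> t + 1"
  proof (rule ccontr)
    assume "\<not> ?thesis"
    then have "t + 1 \<le> c j" if "j < r" for j using c[OF i that] by simp
    then have "(\<Sum>j<r. t + 1) \<le> (\<Sum>j<r. c j)" by (intro sum_mono) auto
    then show False using hi by simp
  qed
  show "t + 1 \<le> c i + 1"
  proof (rule ccontr)
    assume n: "\<not> ?thesis"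
    then have "c j \<le> t" if "j < r" for j using c[OF that i] by simp
    then have "(\<Sum>j<r. c j) < (\<Sum>j<r. t)" using i n by (intro sum_strict_mono_ex1) (auto intro!: bexI[of _ i])
    then show False using lo by simp
  qed
qed

lemma sparse_graph_equitable:
  assumes "sparse_graph V adj r d"
  shows "\<exists>f::'a \<Rightarrow> nat. (\<forall>x\<in>V. f x < r) \<and> (\<forall>x\<in>V. \<forall>y\<in>V. adj x y \<longrightarrow> f x \<noteq> f y) \<and>
    (\<forall>i<r. \<forall>j<r. card {x \<in> V. f x = i} \<le> card {x \<in> V. f x = j} + 1)"
  using assms
proof (induction "card V" arbitrary: V rule: less_induct)
  case less
  interpret sparse_graph V adj r d by (rule less.prems)
  show ?case
  proof (cases "V = {}")
    case True
    then show ?thesis by simp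
  next
    case False
    then obtain v where v: "v \<in> V" "real (nb v V) \<le> 79/100 * real r"
      using exists_light_vertex by blast
    have "card (V - {v}) < card V" using v(1) finite_V by (intro psubset_card_mono) auto
    from less.hyps[OF this sparse_graph_subset] obtain f :: "'a \<Rightarrow> nat" where f: "\<forall>x\<in>V - {v}. f x < r"
      "\<forall>x\<in>V - {v}. \<forall>y\<in>V - {v}. adj x y \<longrightarrow> f x \<noteq> f y"
      "\<forall>i<r. \<forall>j<r. card {x \<in> V - {v}. f x = i} \<le> card {x \<in> V - {v}. f x = j} + 1"
      by blast
    \<comment> \<open>The classes of the smaller graph have size \<open>t\<close> or
      \<open>t + 1\<close>, so \<open>s = t + 1\<close> fits, and one more vertex still keeps the
      total within \<open>r * (t + 1)\<close>.\<close>
    define t where "t = card (V - {v}) div r"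
    let ?c = "\<lambda>i. card {x \<in> V - {v}. f x = i}"
    interpret X: sparse_graph "V - {v}" adj r d by (rule sparse_graph_subset) auto
    have "(\<Sum>i<r. ?c i) = card {x \<in> V - {v}. f x \<in> {..<r}}"
      using X.card_preimage[of "{..<r}" f] by (simp add: X.cls_def)
    also have "{x \<in> V - {v}. f x \<in> {..<r}} = V - {v}" using f(1) by auto
    finally have sum: "(\<Sum>i<r. ?c i) = card (V - {v})" .
    have lo: "r * t \<le> card (V - {v})" by (simp add: t_def)
    have hi: "card (V - {v}) < r * (t + 1)"
      using r_ge_1 dividend_less_times_div[of r "card (V - {v})"] by (simp add: t_def)
    have "card V = card (V - {v}) + 1"
      using v(1) finite_V by (metis Suc_eq_plus1 card_Suc_Diff1)
    then have "card V \<le> r * (t + 1)" using hi by simp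
    moreover have "?c i \<le> t + 1 \<and> t + 1 \<le> ?c i + 1" if "i < r" for i
      using equitable_sizes[of r ?c t i] f(3) lo hi sum that by simp
    ultimately have "\<exists>g. balanced g (t + 1)"
    proof (intro extend_colouring[OF v, of "t + 1" f])
      show "f x < r" if "x \<in> V - {v}" for x using f(1) that by blast
      show "f x \<noteq> f y" if "x \<in> V - {v}" "y \<in> V - {v}" "adj x y" for x y using f(2) that by blast
    qed
    then obtain g where g: "balanced g (t + 1)" ..
    show ?thesis
    proof (intro exI[of _ g] conjI)
      show "\<forall>x\<in>V. g x < r" "\<forall>x\<in>V. \<forall>y\<in>V. adj x y \<longrightarrow> g x \<noteq> g y"
        using g by (simp_all add: balanced_def proper_def)
      show "\<forall>i<r. \<forall>j<r. card {x \<in> V. g x = i} \<le> card {x \<in> V. g x = j} + 1"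
        using g unfolding balanced_def cls_def by (meson le_trans)
    qed
  qed
qed

section \<open>From edge sets to the adjacency relation\<close>

lemma graph_finite_edges: "graph V E \<Longrightarrow> finite E"
  by (rule finite_subset[of _ "Pow V"]) (auto simp: graph_def)

lemma degree_eq_neighbours:
  assumes "graph V E"
  shows "card {y \<in> V. {x, y} \<in> E} = degree E x"
proof -
  have "bij_betw (\<lambda>y. {x, y}) {y \<in> V. {x, y} \<in> E} {e \<in> E. x \<in> e}"
    unfolding bij_betw_def
  proof (intro conjI set_eqI iffI)
    show "inj_on (\<lambda>y. {x, y}) {y \<in> V. {x, y} \<in> E}" by (auto simp: inj_on_def doubleton_eq_iff)
  next
    fix e assume "e \<in> {e \<in> E. x \<in> e}"
    then have e: "e \<in> E" "x \<in> e" "card e = 2" "e \<subseteq> V" using assms by (auto simp: graph_def)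
    then obtain y where "e = {x, y}" by (auto simp: card_2_iff)
    with e show "e \<in> (\<lambda>y. {x, y}) ` {y \<in> V. {x, y} \<in> E}" by auto
  qed auto
  then show ?thesis unfolding degree_def by (rule bij_betw_same_card)
qed

lemma sum_degree:
  assumes "graph V E"
  shows "(\<Sum>x\<in>V. degree E x) = 2 * card E"
proof -
  have "(\<Sum>x\<in>V. degree E x) = (\<Sum>x\<in>V. \<Sum>e | e \<in> E \<and> x \<in> e. 1)" by (simp add: degree_def)
  also have "\<dots> = (\<Sum>e\<in>E. \<Sum>x | x \<in> V \<and> x \<in> e. 1)"
    using assms graph_finite_edges by (intro sum.swap_restrict) (auto simp: graph_def)
  also have "\<dots> = (\<Sum>e\<in>E. 2)"
  proof (rule sum.cong[OF refl])
    fix e assume "e \<in> E"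
    then have "{x. x \<in> V \<and> x \<in> e} = e" "card e = 2" using assms by (auto simp: graph_def)
    then show "(\<Sum>x | x \<in> V \<and> x \<in> e. 1) = (2::nat)" by simp
  qed
  finally show ?thesis by simp
qed

theorem theorem2:
  fixes V :: "'a set" and E :: "'a set set" and d :: real
  assumes "graph V E"
    and "d > 0"
    and "\<And>V' E'. subgraph V' E' V E \<Longrightarrow> real (card E') \<le> d * real (card V')"
    and "real (max_degree V E) \<ge> 6.21 * d"
  shows "\<forall>r::nat. r \<ge> max_degree V E \<longrightarrow> has_equitable_coloring V E r"
proof (intro allI impI)
  fix r assume r: "max_degree V E \<le> r"
  define adj where "adj x y \<longleftrightarrow> {x, y} \<in> E" for x y
  have finV: "finite V" using assms(1) by (simp add: graph_def)
  interpret vertex_colouring V adj r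
  proof unfold_locales
    fix x y assume "adj x y" then show "adj y x" by (simp add: adj_def insert_commute)
  next
    fix x show "\<not> adj x x" using assms(1) by (auto simp: adj_def graph_def)
  qed (fact finV)
  have "sparse_graph V adj r d"
  proof unfold_locales
    show dr: "6.21 * d \<le> real r" using order_trans[OF assms(4) of_nat_mono[OF r]] .
    have "0 < 6.21 * d" using assms(2) by simp
    then have "0 < real r" using dr by (rule less_le_trans)
    then show "1 \<le> r" by simp
    show "0 \<le> d" using assms(2) by simp
  next
    fix x assume x: "x \<in> V"
    have "nb x V = degree E x"
      using degree_eq_neighbours[OF assms(1)] by (simp add: nb_def adj_def)
    also have "\<dots> \<le> max_degree V E" unfolding max_degree_def using x finV by (intro Max_ge) auto
    finally show "nb x V \<le> r" using r by simp
  next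
    fix X assume X: "X \<subseteq> V"
    \<comment> \<open>The induced subgraph on \<open>X\<close> turns the bound on edges into the
      bound on degree sums.\<close>
    define F where "F = {e \<in> E. e \<subseteq> X}"
    have g: "graph X F" using assms(1) X finite_subset[OF X finV] by (auto simp: graph_def F_def)
    have "nb x X = degree F x" if "x \<in> X" for x
    proof -
      have "{y \<in> X. {x, y} \<in> E} = {y \<in> X. {x, y} \<in> F}" using that by (auto simp: F_def)
      then show ?thesis using degree_eq_neighbours[OF g, of x] by (simp add: nb_def adj_def)
    qed
    then have "(\<Sum>x\<in>X. nb x X) = 2 * card F" using sum_degree[OF g] by simp
    moreover have "subgraph X F V E" using g X by (auto simp: subgraph_def F_def)
    ultimately show "real (\<Sum>x\<in>X. nb x X) \<le> 2 * d * real (card X)" using assms(3)[of X F] by simp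
  qed
  then obtain f :: "'a \<Rightarrow> nat" where f: "\<forall>x\<in>V. f x < r"
    "\<forall>x\<in>V. \<forall>y\<in>V. adj x y \<longrightarrow> f x \<noteq> f y"
    "\<forall>i<r. \<forall>j<r. card {x \<in> V. f x = i} \<le> card {x \<in> V. f x = j} + 1"
    using sparse_graph_equitable by blast
  have "independent E {x \<in> V. f x = i}" for i
    unfolding independent_def
  proof (intro ballI notI)
    fix e assume e: "e \<in> E" "e \<subseteq> {x \<in> V. f x = i}"
    then obtain x y where "e = {x, y}" using assms(1) by (auto simp: graph_def card_2_iff)
    then have "x \<in> V" "y \<in> V" "f x = f y" "adj x y" using e by (auto simp: adj_def)
    then show False using f(2) by blast
  qed
  then have "equitable_coloring V E r (\<lambda>i. {x \<in> V. f x = i})"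
    using f(1,3) by (auto simp: equitable_coloring_def disjoint_family_on_def)
  then show "has_equitable_coloring V E r" by (auto simp: has_equitable_coloring_def)
qed

end
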